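(* Let $\mathcal{A}=\bigcup_\alpha X_\alpha$ be a unital strong algebra and let $\mathcal{U}=\bigcup_\alpha Y_\alpha$ be the Wiener algebra associated to $\mathcal{A}$. For any $a\in\mathcal{U}$, $a$ is left invertible in $\mathcal{U}$ if and only if $a(t)$ is left invertible in $\mathcal{A}$ for every $t\in[-\pi,\pi)$.
   Context: Inductive limit of Banach spaces: a complex vector space $X$ with a family $\{X_\alpha:\alpha\in A\}$ of subspaces, $X_\alpha\ne X_\beta$ for $\alpha\neq\beta$, directed under inclusion, with $X=\bigcup_\alpha X_\alpha$; the index set $A$ is directed by $\alpha\le\beta$ iff $X_\alpha\subseteq X_\beta$. Each $X_\alpha$ is a Banach space with norm $\|\cdot\|_\alpha$, and whenever $\alpha\le\beta$ the topology induced by $\|\cdot\|_\beta$ on $X_\alpha$ is coarser than that induced by $\|\cdot\|_\alpha$. $X$ carries the inductive limit topology: the finest locally convex topology making all inclusions $X_\alpha\hookrightarrow X$ continuous. Strong algebra: an inductive limit $\mathcal{A}=\bigcup_{\alpha\in A} X_\alpha$ of Banach spaces which is also an (associative) algebra such that for any $\alpha\in A$ there exists $h(\alpha)\in A$ such that for any $\beta\ge h(\alpha)$ there is a positive constant $A_{\beta,\alpha}$ with $\|ab\|_\beta\le A_{\beta,\alpha}\|a\|_\alpha\|b\|_\beta$ and $\|ba\|_\beta\le A_{\beta,\alpha}\|a\|_\alpha\|b\|_\beta$ for every $a\in X_\alpha$, $b\in X_\beta$. Unital means that $\mathcal{A}$ has a multiplicative unit $1$. Wiener algebra associated to $\mathcal{A}$: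 $Y_\alpha$ is the Banach space of periodic functions $a(t)=\sum_{n\in\mathbb{Z}}a_ne^{int}$, $a_n\in X_\alpha$, on $-\pi\le t<\pi$ to $\mathcal{A}$, with $\|a\|_\alpha=\sum_{n\in\mathbb{Z}}\|a_n\|_\alpha<\infty$; $\mathcal{U}=\bigcup_\alpha Y_\alpha$ is the inductive limit of the Banach spaces $Y_\alpha$, with pointwise multiplication. An element $a$ is left invertible if there is $a'$ in the same algebra with $a'a=1$. *)

theory Defs
  imports "HOL-Analysis.Analysis" "HOL-Library.Function_Algebras"
begin

section \<open>Complex Banach spaces carried by a subspace\<close>

text \<open>
  The distance is set to 0 outside \<open>S\<close>, where \<open>N\<close> is arbitrary, because
  \<^locale>\<open>Metric_space\<close> asks for symmetry and nonnegativity on the whole type.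
\<close>

definition norm_dist :: "'a::ab_group_add set \<Rightarrow> ('a \<Rightarrow> real) \<Rightarrow> 'a \<Rightarrow> 'a \<Rightarrow> real" where
  "norm_dist S N x y = (if x \<in> S \<and> y \<in> S then N (x - y) else 0)"

definition norm_topology :: "'a::ab_group_add set \<Rightarrow> ('a \<Rightarrow> real) \<Rightarrow> 'a topology" where
  "norm_topology S N = Metric_space.mtopology S (norm_dist S N)"

locale complex_normed_subspace = vector_space scaleC
  for scaleC :: "complex \<Rightarrow> 'a::ab_group_add \<Rightarrow> 'a" +
  fixes S :: "'a set" and N :: "'a \<Rightarrow> real"
  assumes subspace_carrier: "subspace S"
    and norm_nonneg: "\<And>x. x \<in> S \<Longrightarrow> 0 \<le> N x"
    and norm_eq_0: "\<And>x. x \<in> S \<Longrightarrow> N x = 0 \<longleftrightarrow> x = 0"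
    and norm_scale: "\<And>c x. x \<in> S \<Longrightarrow> N (scaleC c x) = cmod c * N x"
    and norm_triangle: "\<And>x y. x \<in> S \<Longrightarrow> y \<in> S \<Longrightarrow> N (x + y) \<le> N x + N y"
begin

lemma norm_minus_commute_carrier:
  assumes "x \<in> S" "y \<in> S"
  shows "N (x - y) = N (y - x)"
proof -
  have "N (scaleC (-1) (y - x)) = cmod (-1) * N (y - x)"
    using assms subspace_carrier by (intro norm_scale) (rule subspace_diff)
  then show ?thesis by simp
qed

sublocale Metric_space S "norm_dist S N"
proof
  fix x y z
  show "0 \<le> norm_dist S N x y"
    by (auto simp: norm_dist_def intro!: norm_nonneg subspace_diff subspace_carrier)
  show "norm_dist S N x y = norm_dist S N y x"
    by (auto simp: norm_dist_def norm_minus_commute_carrier)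
  show "norm_dist S N x y = 0 \<longleftrightarrow> x = y" if "x \<in> S" "y \<in> S"
    using that by (simp add: norm_dist_def norm_eq_0 subspace_diff subspace_carrier)
  show "norm_dist S N x z \<le> norm_dist S N x y + norm_dist S N y z"
    if "x \<in> S" "y \<in> S" "z \<in> S"
    using that norm_triangle[of "x - y" "y - z"]
    by (simp add: norm_dist_def subspace_diff subspace_carrier)
qed

end

locale complex_banach_subspace = complex_normed_subspace +
  assumes complete: mcomplete

section \<open>Inductive limits of Banach spaces\<close>

locale banach_inductive_limit = vector_space scaleC
  for scaleC :: "complex \<Rightarrow> 'a::ab_group_add \<Rightarrow> 'a" +
  fixes A :: "'i set" and X :: "'i \<Rightarrow> 'a set" and nrm :: "'i \<Rightarrow> 'a \<Rightarrow> real"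
  assumes banach: "\<And>\<alpha>. \<alpha> \<in> A \<Longrightarrow> complex_banach_subspace scaleC (X \<alpha>) (nrm \<alpha>)"
    and distinct_steps: "inj_on X A"
    and directed: "\<And>\<alpha> \<beta>. \<alpha> \<in> A \<Longrightarrow> \<beta> \<in> A \<Longrightarrow> \<exists>\<gamma>\<in>A. X \<alpha> \<subseteq> X \<gamma> \<and> X \<beta> \<subseteq> X \<gamma>"
    and coarser: "\<And>\<alpha> \<beta> U. \<alpha> \<in> A \<Longrightarrow> \<beta> \<in> A \<Longrightarrow> X \<alpha> \<subseteq> X \<beta> \<Longrightarrow>
          openin (subtopology (norm_topology (X \<beta>) (nrm \<beta>)) (X \<alpha>)) U \<Longrightarrow>
          openin (norm_topology (X \<alpha>) (nrm \<alpha>)) U"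
    and Union_steps: "(\<Union>\<alpha>\<in>A. X \<alpha>) = UNIV"

definition locally_convex_topology ::
  "(complex \<Rightarrow> 'a::ab_group_add \<Rightarrow> 'a) \<Rightarrow> 'a set \<Rightarrow> 'a topology \<Rightarrow> bool" where
  "locally_convex_topology scaleC V T \<longleftrightarrow>
     topspace T = V \<and>
     continuous_map (prod_topology T T) T (\<lambda>(x, y). x + y) \<and>
     continuous_map (prod_topology euclidean T) T (\<lambda>(c, x). scaleC c x) \<and>
     (\<forall>U. openin T U \<and> 0 \<in> U \<longrightarrow>
        (\<exists>C. openin T C \<and> 0 \<in> C \<and> C \<subseteq> U \<and>
             (\<forall>x\<in>C. \<forall>y\<in>C. \<forall>u::real. 0 \<le> u \<and> u \<le> 1 \<longrightarrow>
                scaleC (of_real u) x + scaleC (of_real (1 - u)) y \<in> C)))"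

text \<open>
  The inductive limit topology is determined by the steps and their norms, so it is a
  defined object and not a parameter of \<^locale>\<open>banach_inductive_limit\<close>. Invertibility is a
  purely algebraic notion and does not refer to it.
\<close>

definition inductive_limit_topology ::
  "(complex \<Rightarrow> 'a::ab_group_add \<Rightarrow> 'a) \<Rightarrow> 'i set \<Rightarrow> ('i \<Rightarrow> 'a set) \<Rightarrow> ('i \<Rightarrow> 'a \<Rightarrow> real)
    \<Rightarrow> 'a topology" where
  "inductive_limit_topology scaleC A X nrm =
     (let admissible = (\<lambda>T. locally_convex_topology scaleC (\<Union>\<alpha>\<in>A. X \<alpha>) T \<and>
            (\<forall>\<alpha>\<in>A. continuous_map (norm_topology (X \<alpha>) (nrm \<alpha>)) T (\<lambda>x. x)))
      in THE T. admissible T \<and> (\<forall>T' U. admissible T' \<and> openin T' U \<longrightarrow> openin T U))"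

section \<open>Strong algebras\<close>

text \<open>
  That the products \<open>a * b\<close> and \<open>b * a\<close> lie in \<open>X \<beta>\<close> is implicit in writing down their
  \<open>\<beta>\<close>-norms. The unit is supplied by the sort \<open>{ring, monoid_mult}\<close> where needed
  (unlike \<^class>\<open>ring_1\<close>, this sort does not exclude the zero algebra).
\<close>

locale strong_algebra = banach_inductive_limit scaleC A X nrm
  for scaleC :: "complex \<Rightarrow> 'a::ring \<Rightarrow> 'a"
    and A :: "'i set" and X :: "'i \<Rightarrow> 'a set" and nrm :: "'i \<Rightarrow> 'a \<Rightarrow> real" +
  assumes mult_scale_left: "\<And>c a b. scaleC c a * b = scaleC c (a * b)"
    and mult_scale_right: "\<And>c a b. a * scaleC c b = scaleC c (a * b)"
    and strong: "\<And>\<alpha>. \<alpha> \<in> A \<Longrightarrow> \<exists>h\<in>A. \<forall>\<beta>\<in>A. X h \<subseteq> X \<beta> \<longrightarrow>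
          (\<exists>C>0. \<forall>a\<in>X \<alpha>. \<forall>b\<in>X \<beta>.
             a * b \<in> X \<beta> \<and> nrm \<beta> (a * b) \<le> C * nrm \<alpha> a * nrm \<beta> b \<and>
             b * a \<in> X \<beta> \<and> nrm \<beta> (b * a) \<le> C * nrm \<alpha> a * nrm \<beta> b)"

section \<open>The associated Wiener algebra\<close>

text \<open>
  The series is summed unconditionally in the Banach space \<open>(S, N)\<close>, where it converges
  absolutely. Periodic functions on \<open>[-pi, pi)\<close> are represented by their \<open>2 * pi\<close>-periodic
  extensions to the real line, given by the same series.
\<close>

definition wiener_series ::
  "(complex \<Rightarrow> 'a::ab_group_add \<Rightarrow> 'a) \<Rightarrow> 'a set \<Rightarrow> ('a \<Rightarrow> real) \<Rightarrow> (int \<Rightarrow> 'a) \<Rightarrow> (real \<Rightarrow> 'a) \<Rightarrow> bool"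
  where
  "wiener_series scaleC S N c f \<longleftrightarrow>
     range c \<subseteq> S \<and>
     (\<lambda>n. N (c n)) summable_on UNIV \<and>
     (\<forall>t. limitin (norm_topology S N)
            (\<lambda>F. \<Sum>n\<in>F. scaleC (exp (\<i> * of_int n * of_real t)) (c n)) (f t)
            (finite_subsets_at_top UNIV))"

definition wiener_space ::
  "(complex \<Rightarrow> 'a::ab_group_add \<Rightarrow> 'a) \<Rightarrow> 'a set \<Rightarrow> ('a \<Rightarrow> real) \<Rightarrow> (real \<Rightarrow> 'a) set" where
  "wiener_space scaleC S N = {f. \<exists>c. wiener_series scaleC S N c f}"

text \<open>The coefficients of an element of the Wiener space are uniquely determined.\<close>

definition wiener_norm ::
  "(complex \<Rightarrow> 'a::ab_group_add \<Rightarrow> 'a) \<Rightarrow> 'a set \<Rightarrow> ('a \<Rightarrow> real) \<Rightarrow> (real \<Rightarrow> 'a) \<Rightarrow> real" where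
  "wiener_norm scaleC S N f = (\<Sum>\<^sub>\<infinity>n. N ((THE c. wiener_series scaleC S N c f) n))"

definition wiener_algebra ::
  "(complex \<Rightarrow> 'a::ab_group_add \<Rightarrow> 'a) \<Rightarrow> 'i set \<Rightarrow> ('i \<Rightarrow> 'a set) \<Rightarrow> ('i \<Rightarrow> 'a \<Rightarrow> real)
    \<Rightarrow> (real \<Rightarrow> 'a) set" where
  "wiener_algebra scaleC A X nrm = (\<Union>\<alpha>\<in>A. wiener_space scaleC (X \<alpha>) (nrm \<alpha>))"

definition wiener_topology ::
  "(complex \<Rightarrow> 'a::ab_group_add \<Rightarrow> 'a) \<Rightarrow> 'i set \<Rightarrow> ('i \<Rightarrow> 'a set) \<Rightarrow> ('i \<Rightarrow> 'a \<Rightarrow> real)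
    \<Rightarrow> (real \<Rightarrow> 'a) topology" where
  "wiener_topology scaleC A X nrm =
     inductive_limit_topology (\<lambda>c f t. scaleC c (f t)) A
       (\<lambda>\<alpha>. wiener_space scaleC (X \<alpha>) (nrm \<alpha>)) (\<lambda>\<alpha>. wiener_norm scaleC (X \<alpha>) (nrm \<alpha>))"

section \<open>Left invertibility\<close>

definition left_invertible_in :: "'a::{times,one} set \<Rightarrow> 'a \<Rightarrow> bool" where
  "left_invertible_in R a \<longleftrightarrow> (\<exists>a'\<in>R. a' * a = 1)"

end

theory Submission
  imports Defs
begin

text \<open>
  If \<open>a' * a = 1\<close> in the Wiener algebra, then evaluation at \<open>t\<close> gives a left inverse of \<open>a t\<close>.
  For the converse, Wiener's localization argument is carried out with coefficients in the strong
  algebra. The functions that localize are scalar, so they commute with everything.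

  Suppose \<open>b * a t0 = 1\<close>. The function \<open>f = b * a - 1\<close> vanishes at \<open>t0\<close> and lies in the Wiener
  space of one step \<open>X \<alpha>\<close>. If \<open>\<phi>\<close> is a scalar cutoff function that equals 1 near \<open>t0\<close> and is
  concentrated enough, then \<open>\<phi> * f\<close> has arbitrarily small norm in that same space
  (\<open>wiener_localization\<close>). The defining inequality of a strong algebra provides a step
  \<open>X \<delta>\<close> containing 1 on which right multiplication by \<open>x = - \<phi> * f\<close> is bounded by the
  \<open>\<alpha>\<close>-norm of \<open>x\<close>, so that the Neumann series of \<open>x\<close> converges absolutely and yields \<open>y\<close> with
  \<open>y * (1 + \<phi> * f) = 1\<close> (\<open>wiener_neumann\<close>). Where \<open>\<phi> = 1\<close>, this reads \<open>y * b * a = 1\<close>, so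
  \<open>y * b\<close> is a left inverse of \<open>a\<close> near \<open>t0\<close> (\<open>local_left_inverse\<close>). By compactness of the
  circle, finitely many such local left inverses \<open>h\<^sub>j\<close> suffice, and a partition of unity
  \<open>T\<^sub>j\<close> by translates of one triangle function glues them: \<open>(\<Sum>\<^sub>j T\<^sub>j * h\<^sub>j) * a = \<Sum>\<^sub>j T\<^sub>j = 1\<close>.

  The localization step needs scalar functions with small support and controlled absolutely
  convergent Fourier series. Triangle functions serve, both for the cutoff and for the partition
  of unity. Their Fourier expansion follows from that of the periodic quadratic polynomial
  \<open>\<Sum>\<^sub>k cos (k * t) / k\<^sup>2\<close>, the real part of the dilogarithm on the unit circle: a second difference
  of the quadratic is constant except near its kink at the multiples of \<open>2 * pi\<close>.

  Products, Neumann series and cutoffs are all handled by one device: each of them is a sum of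
  terms \<open>exp (i \<nu> t) c\<close> over some index set (pairs or lists of integers), absolutely convergent
  in a single step, and collecting the terms of equal frequency \<open>\<nu>\<close> turns such a family into a
  Wiener series (\<open>wiener_series_of_family\<close>, resting on \<open>abs_sums_regroup\<close>).
\<close>

section \<open>Absolutely convergent sums in a normed subspace\<close>

lemma filterlim_Int_finite_subsets_at_top:
  assumes "I \<subseteq> J"
  shows "filterlim (\<lambda>F. F \<inter> I) (finite_subsets_at_top I) (finite_subsets_at_top J)"
  unfolding filterlim_def le_filter_def eventually_filtermap
proof (intro allI impI)
  fix P assume "eventually P (finite_subsets_at_top I)"
  then obtain X where X: "finite X" "X \<subseteq> I" "\<And>Y. finite Y \<Longrightarrow> X \<subseteq> Y \<Longrightarrow> Y \<subseteq> I \<Longrightarrow> P Y"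
    unfolding eventually_finite_subsets_at_top by auto
  show "\<forall>\<^sub>F F in finite_subsets_at_top J. P (F \<inter> I)"
    unfolding eventually_finite_subsets_at_top
    using X assms by (intro exI[of _ X]) auto
qed

context complex_normed_subspace
begin

text \<open>
  Convergence is measured by \<open>N\<close> because the ambient type carries no topology.
  Absolute summability belongs to the notion, so that every subfamily is summable as well once
  the space is complete.
\<close>

definition abs_sums :: "('k \<Rightarrow> 'a) \<Rightarrow> 'k set \<Rightarrow> 'a \<Rightarrow> bool" where
  "abs_sums c I x \<longleftrightarrow> c ` I \<subseteq> S \<and> (\<lambda>i. N (c i)) summable_on I \<and> x \<in> S \<and>
     ((\<lambda>F. N (sum c F - x)) \<longlongrightarrow> 0) (finite_subsets_at_top I)"

lemma norm_0: "N 0 = 0"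
  using norm_eq_0[OF subspace_0[OF subspace_carrier]] by simp

lemma norm_triangle_diff:
  assumes "x \<in> S" "y \<in> S" "z \<in> S"
  shows "N (x - y) \<le> N (z - x) + N (z - y)"
proof -
  have "N ((x - z) + (z - y)) \<le> N (x - z) + N (z - y)"
    using assms by (intro norm_triangle) (auto intro: subspace_diff subspace_carrier)
  then show ?thesis using norm_minus_commute_carrier assms by simp
qed

lemma sum_in_carrier: "c ` F \<subseteq> S \<Longrightarrow> sum c F \<in> S"
  by (auto intro: subspace_sum[OF subspace_carrier])

lemma norm_sum_le: "c ` F \<subseteq> S \<Longrightarrow> N (sum c F) \<le> (\<Sum>i\<in>F. N (c i))"
proof (induction F rule: infinite_finite_induct)
  case (insert i F)
  have "N (c i + sum c F) \<le> N (c i) + N (sum c F)"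
    using insert.prems by (intro norm_triangle sum_in_carrier) auto
  then show ?case using insert by simp
qed (auto simp: norm_0)

lemma sum_diff_in_carrier: "c ` I \<subseteq> S \<Longrightarrow> F \<subseteq> I \<Longrightarrow> x \<in> S \<Longrightarrow> sum c F - x \<in> S"
  by (intro subspace_diff[OF subspace_carrier] sum_in_carrier) auto

lemma abs_sums_unique:
  assumes "abs_sums c I x" "abs_sums c I y"
  shows "x = y"
proof -
  have lim: "((\<lambda>F. N (sum c F - x) + N (sum c F - y)) \<longlongrightarrow> 0 + 0) (finite_subsets_at_top I)"
    using assms by (intro tendsto_add) (auto simp: abs_sums_def)
  have "N (x - y) \<le> 0 + 0"
  proof (rule tendsto_lowerbound[OF lim])
    show "\<forall>\<^sub>F F in finite_subsets_at_top I. N (x - y) \<le> N (sum c F - x) + N (sum c F - y)"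
      using assms
      by (intro eventually_finite_subsets_at_top_weakI norm_triangle_diff sum_in_carrier)
         (auto simp: abs_sums_def)
  qed simp
  moreover have "x - y \<in> S" using assms subspace_diff[OF subspace_carrier] by (auto simp: abs_sums_def)
  ultimately show ?thesis using norm_nonneg[of "x - y"] norm_eq_0[of "x - y"] by auto
qed

lemma abs_sums_norm_le:
  assumes "abs_sums c I x"
  shows "N x \<le> (\<Sum>\<^sub>\<infinity>i\<in>I. N (c i))"
proof -
  have lim: "((\<lambda>F. N (sum c F - x)) \<longlongrightarrow> 0) (finite_subsets_at_top I)"
    using assms by (auto simp: abs_sums_def)
  have "N x - (\<Sum>\<^sub>\<infinity>i\<in>I. N (c i)) \<le> 0"
  proof (rule tendsto_lowerbound[OF lim])
    show "\<forall>\<^sub>F F in finite_subsets_at_top I. N x - (\<Sum>\<^sub>\<infinity>i\<in>I. N (c i)) \<le> N (sum c F - x)"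
    proof (rule eventually_finite_subsets_at_top_weakI)
      fix F assume F: "finite F" "F \<subseteq> I"
      have c: "c ` F \<subseteq> S" "x \<in> S" "c ` I \<subseteq> S" using assms F by (auto simp: abs_sums_def)
      have "N (x - 0) \<le> N (sum c F - x) + N (sum c F - 0)"
        using c sum_in_carrier subspace_0[OF subspace_carrier] by (intro norm_triangle_diff) auto
      also have "N (sum c F - 0) \<le> (\<Sum>i\<in>F. N (c i))" using norm_sum_le c by simp
      also have "\<dots> \<le> (\<Sum>\<^sub>\<infinity>i\<in>I. N (c i))"
        using assms F c by (intro finite_sum_le_infsum) (auto simp: abs_sums_def intro!: norm_nonneg)
      finally show "N x - (\<Sum>\<^sub>\<infinity>i\<in>I. N (c i)) \<le> N (sum c F - x)" by simp
    qed
  qed simp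
  then show ?thesis by simp
qed

lemma abs_sums_finite:
  assumes "finite F" "c ` F \<subseteq> S"
  shows "abs_sums c F (sum c F)"
  using assms sum_in_carrier
  by (auto simp: abs_sums_def finite_subsets_at_top_finite norm_0 eventually_principal intro!: tendsto_eventually)

lemma abs_sums_cong:
  assumes "\<And>i. i \<in> I \<Longrightarrow> c i = d i"
  shows "abs_sums c I x \<longleftrightarrow> abs_sums d I x"
proof -
  have "((\<lambda>F. N (sum c F - x)) \<longlongrightarrow> 0) (finite_subsets_at_top I) \<longleftrightarrow>
        ((\<lambda>F. N (sum d F - x)) \<longlongrightarrow> 0) (finite_subsets_at_top I)"
  proof (rule tendsto_cong, rule eventually_finite_subsets_at_top_weakI)
    fix F assume "finite F" "F \<subseteq> I"
    then have "sum c F = sum d F" using assms by (intro sum.cong) auto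
    then show "N (sum c F - x) = N (sum d F - x)" by simp
  qed
  moreover have "c ` I = d ` I" using assms by auto
  moreover have "(\<lambda>i. N (c i)) summable_on I \<longleftrightarrow> (\<lambda>i. N (d i)) summable_on I"
    using assms by (intro summable_on_cong) auto
  ultimately show ?thesis unfolding abs_sums_def by simp
qed

lemma abs_sums_reindex:
  assumes "inj_on h I"
  shows "abs_sums c (h ` I) x \<longleftrightarrow> abs_sums (\<lambda>i. c (h i)) I x"
proof -
  have "((\<lambda>F. N (sum c F - x)) \<longlongrightarrow> 0) (finite_subsets_at_top (h ` I)) \<longleftrightarrow>
        ((\<lambda>F. N (sum c (h ` F) - x)) \<longlongrightarrow> 0) (finite_subsets_at_top I)"
    by (simp flip: filtermap_image_finite_subsets_at_top[OF assms] add: filterlim_filtermap)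
  also have "\<dots> \<longleftrightarrow> ((\<lambda>F. N ((\<Sum>i\<in>F. c (h i)) - x)) \<longlongrightarrow> 0) (finite_subsets_at_top I)"
    by (rule tendsto_cong, rule eventually_finite_subsets_at_top_weakI)
       (subst sum.reindex, auto intro: inj_on_subset[OF assms])
  finally show ?thesis
    unfolding abs_sums_def using summable_on_reindex[OF assms, of "\<lambda>i. N (c i)"]
    by (simp add: image_image o_def)
qed

lemma abs_sums_Un:
  assumes "abs_sums c I x" "abs_sums c J y" "I \<inter> J = {}"
  shows "abs_sums c (I \<union> J) (x + y)"
proof -
  have S: "c ` (I \<union> J) \<subseteq> S" "x \<in> S" "y \<in> S"
    using assms by (auto simp: abs_sums_def)
  have lim: "((\<lambda>F. N (sum c (F \<inter> I) - x) + N (sum c (F \<inter> J) - y)) \<longlongrightarrow> 0 + 0)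
        (finite_subsets_at_top (I \<union> J))"
    using assms
    by (intro tendsto_add; intro filterlim_compose[OF _ filterlim_Int_finite_subsets_at_top])
       (auto simp: abs_sums_def)
  have "((\<lambda>F. N (sum c F - (x + y))) \<longlongrightarrow> 0) (finite_subsets_at_top (I \<union> J))"
  proof (rule Lim_null_comparison)
    show "\<forall>\<^sub>F F in finite_subsets_at_top (I \<union> J).
        norm (N (sum c F - (x + y))) \<le> N (sum c (F \<inter> I) - x) + N (sum c (F \<inter> J) - y)"
    proof (rule eventually_finite_subsets_at_top_weakI)
      fix F assume F: "finite F" "F \<subseteq> I \<union> J"
      have "F = (F \<inter> I) \<union> (F \<inter> J)" using F by auto
      then have "sum c F = sum c (F \<inter> I) + sum c (F \<inter> J)"
        using F assms(3) by (metis (no_types, lifting) finite_Int inf_assoc inf_bot_right inf_commute sum.union_disjoint)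
      then have eq: "sum c F - (x + y) = (sum c (F \<inter> I) - x) + (sum c (F \<inter> J) - y)" by simp
      have in_S: "sum c (F \<inter> I) - x \<in> S" "sum c (F \<inter> J) - y \<in> S"
        using S by (auto intro!: subspace_diff[OF subspace_carrier] sum_in_carrier)
      have "0 \<le> N (sum c F - (x + y))"
        unfolding eq using in_S by (intro norm_nonneg subspace_add[OF subspace_carrier])
      moreover have "N (sum c F - (x + y)) \<le> N (sum c (F \<inter> I) - x) + N (sum c (F \<inter> J) - y)"
        unfolding eq by (rule norm_triangle[OF in_S])
      ultimately show "norm (N (sum c F - (x + y))) \<le> N (sum c (F \<inter> I) - x) + N (sum c (F \<inter> J) - y)"
        by simp
    qed
  qed (use lim in simp)
  moreover have "(\<lambda>i. N (c i)) summable_on (I \<union> J)"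
    using assms by (intro summable_on_Un_disjoint) (auto simp: abs_sums_def)
  ultimately show ?thesis
    using S by (auto simp: abs_sums_def intro: subspace_add[OF subspace_carrier])
qed

lemma abs_sums_add:
  assumes "abs_sums c I x" "abs_sums d I y"
  shows "abs_sums (\<lambda>i. c i + d i) I (x + y)"
proof -
  have S: "c ` I \<subseteq> S" "d ` I \<subseteq> S" "x \<in> S" "y \<in> S"
    and summ: "(\<lambda>i. N (c i)) summable_on I" "(\<lambda>i. N (d i)) summable_on I"
    using assms by (auto simp: abs_sums_def)
  have lim: "((\<lambda>F. N (sum c F - x) + N (sum d F - y)) \<longlongrightarrow> 0 + 0) (finite_subsets_at_top I)"
    using assms by (intro tendsto_add) (auto simp: abs_sums_def)
  have "((\<lambda>F. N ((\<Sum>i\<in>F. c i + d i) - (x + y))) \<longlongrightarrow> 0) (finite_subsets_at_top I)"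
  proof (rule Lim_null_comparison)
    show "\<forall>\<^sub>F F in finite_subsets_at_top I.
        norm (N ((\<Sum>i\<in>F. c i + d i) - (x + y))) \<le> N (sum c F - x) + N (sum d F - y)"
    proof (rule eventually_finite_subsets_at_top_weakI)
      fix F assume F: "finite F" "F \<subseteq> I"
      have eq: "(\<Sum>i\<in>F. c i + d i) - (x + y) = (sum c F - x) + (sum d F - y)"
        by (simp add: sum.distrib)
      have in_S: "sum c F - x \<in> S" "sum d F - y \<in> S"
        using S F by (auto intro: sum_diff_in_carrier)
      then show "norm (N ((\<Sum>i\<in>F. c i + d i) - (x + y))) \<le> N (sum c F - x) + N (sum d F - y)"
        unfolding eq using norm_triangle[OF in_S] norm_nonneg[OF subspace_add[OF subspace_carrier in_S]]
        by simp
    qed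
  qed (use lim in simp)
  moreover have "(\<lambda>i. N (c i + d i)) summable_on I"
  proof (rule summable_on_comparison_test)
    show "(\<lambda>i. N (c i) + N (d i)) summable_on I" using summ by (rule summable_on_add)
  qed (use S in \<open>auto intro!: norm_triangle norm_nonneg subspace_add[OF subspace_carrier]\<close>)
  ultimately show ?thesis
    using S by (auto simp: abs_sums_def intro!: subspace_add[OF subspace_carrier])
qed

lemma limitin_norm_topology_iff:
  assumes "c ` I \<subseteq> S" "(\<lambda>i. N (c i)) summable_on I"
  shows "limitin (norm_topology S N) (sum c) x (finite_subsets_at_top I) \<longleftrightarrow> abs_sums c I x"
proof -
  have "(\<forall>\<epsilon>>0. \<forall>\<^sub>F F in finite_subsets_at_top I. sum c F \<in> S \<and> norm_dist S N (sum c F) x < \<epsilon>) \<longleftrightarrow>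
        (\<forall>\<epsilon>>0. \<forall>\<^sub>F F in finite_subsets_at_top I. dist (N (sum c F - x)) 0 < \<epsilon>)" if "x \<in> S"
  proof -
    have "(\<forall>\<^sub>F F in finite_subsets_at_top I. sum c F \<in> S \<and> norm_dist S N (sum c F) x < \<epsilon>) \<longleftrightarrow>
        (\<forall>\<^sub>F F in finite_subsets_at_top I. dist (N (sum c F - x)) 0 < \<epsilon>)" for \<epsilon>
    proof (rule eventually_cong[OF eventually_finite_subsets_at_top_weakI[OF _]])
      fix F assume F: "F \<subseteq> I"
      then have "sum c F \<in> S" using assms by (intro sum_in_carrier) auto
      then show "(sum c F \<in> S \<and> norm_dist S N (sum c F) x < \<epsilon>) = (dist (N (sum c F - x)) 0 < \<epsilon>)"
        using that norm_nonneg[of "sum c F - x"] subspace_diff[OF subspace_carrier]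
        by (simp add: norm_dist_def)
    qed
    then show ?thesis by simp
  qed
  then show ?thesis
    unfolding norm_topology_def limitin_metric abs_sums_def tendsto_iff using assms by auto
qed

end

text \<open>
  Passing to a larger step, multiplying by a fixed element and \<open>z \<mapsto> z x\<close> for scalars \<open>z\<close> are all
  bounded additive maps between normed subspaces, possibly with different norms.
\<close>

lemma abs_sums_image:
  assumes "complex_normed_subspace sc S N" "complex_normed_subspace sc' S' N'"
    and T: "Modules.additive T" "\<And>x. x \<in> S \<Longrightarrow> T x \<in> S'" "\<And>x. x \<in> S \<Longrightarrow> N' (T x) \<le> K * N x"
    and c: "complex_normed_subspace.abs_sums S N c I x"
  shows "complex_normed_subspace.abs_sums S' N' (\<lambda>i. T (c i)) I (T x)"
proof -
  interpret N1: complex_normed_subspace sc S N by fact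
  interpret N2: complex_normed_subspace sc' S' N' by fact
  have S: "c ` I \<subseteq> S" "x \<in> S" "(\<lambda>i. N (c i)) summable_on I" using c by (auto simp: N1.abs_sums_def)
  have "((\<lambda>F. N' ((\<Sum>i\<in>F. T (c i)) - T x)) \<longlongrightarrow> 0) (finite_subsets_at_top I)"
  proof (rule Lim_null_comparison)
    show "((\<lambda>F. K * N (sum c F - x)) \<longlongrightarrow> 0) (finite_subsets_at_top I)"
      using c by (intro tendsto_mult_right_zero) (auto simp: N1.abs_sums_def)
    show "\<forall>\<^sub>F F in finite_subsets_at_top I.
        norm (N' ((\<Sum>i\<in>F. T (c i)) - T x)) \<le> K * N (sum c F - x)"
    proof (rule eventually_finite_subsets_at_top_weakI)
      fix F assume F: "finite F" "F \<subseteq> I"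
      have eq: "(\<Sum>i\<in>F. T (c i)) - T x = T (sum c F - x)"
        using T(1) by (simp add: Modules.additive.diff Modules.additive.sum)
      have "sum c F - x \<in> S"
        using S F by (intro N1.sum_diff_in_carrier)
      then show "norm (N' ((\<Sum>i\<in>F. T (c i)) - T x)) \<le> K * N (sum c F - x)"
        unfolding eq using T(2,3) N2.norm_nonneg by simp
    qed
  qed
  moreover have "(\<lambda>i. N' (T (c i))) summable_on I"
  proof (rule summable_on_comparison_test)
    show "(\<lambda>i. K * N (c i)) summable_on I" using S(3) by (rule summable_on_cmult_right)
  qed (use S T(2,3) in \<open>auto intro!: N2.norm_nonneg\<close>)
  ultimately show ?thesis
    using S T(2) by (auto simp: N2.abs_sums_def)
qed

lemma (in complex_normed_subspace) abs_sums_scale: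
  assumes "abs_sums c I x"
  shows "abs_sums (\<lambda>i. scaleC k (c i)) I (scaleC k x)"
  by (rule abs_sums_image[OF complex_normed_subspace_axioms complex_normed_subspace_axioms _ _ _ assms,
        where K = "cmod k"])
     (auto simp: Modules.additive_def scale_right_distrib norm_scale intro: subspace_scale[OF subspace_carrier])

context complex_banach_subspace
begin

text \<open>
  Completeness is available only for sequences. The partial sums over finite sets \<open>F n\<close> that
  exhaust the sum of the norms up to \<open>1 / (n + 1)\<close> form a Cauchy sequence, because two partial sums
  differ by terms outside one of these sets. Its limit is the limit over all finite sets.
\<close>

lemma abs_sums_exists:
  assumes c: "c ` I \<subseteq> S" and summ: "(\<lambda>i. N (c i)) summable_on I"
  shows "\<exists>x. abs_sums c I x"
proof -
  let ?s = "\<Sum>\<^sub>\<infinity>i\<in>I. N (c i)"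
  have nonneg: "\<And>i. i \<in> I \<Longrightarrow> 0 \<le> N (c i)" using c by (auto intro: norm_nonneg)
  have "\<exists>F. finite F \<and> F \<subseteq> I \<and> dist (\<Sum>i\<in>F. N (c i)) ?s \<le> 1 / (1 + real n)" for n
    using has_sum_finite_approximation[of "\<lambda>i. N (c i)" I ?s "1 / (1 + real n)"] summ by auto
  then obtain F where F: "\<And>n. finite (F n)" "\<And>n. F n \<subseteq> I"
    "\<And>n. dist (\<Sum>i\<in>F n. N (c i)) ?s \<le> 1 / (1 + real n)" by metis
  have tail: "(\<Sum>i\<in>G. N (c i)) \<le> 1 / (1 + real n)" if "finite G" "G \<subseteq> I" "G \<inter> F n = {}" for G n
  proof -
    have "(\<Sum>i\<in>G. N (c i)) + (\<Sum>i\<in>F n. N (c i)) = (\<Sum>i\<in>G \<union> F n. N (c i))"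
      using that F by (simp add: sum.union_disjoint)
    also have "\<dots> \<le> ?s"
      using that F summ nonneg by (intro finite_sum_le_infsum) auto
    finally show ?thesis using F(3)[of n] unfolding dist_real_def by linarith
  qed
  have diff: "N (sum c G - sum c H) \<le> 1 / (1 + real m) + 1 / (1 + real n)"
    if G: "finite G" "G \<subseteq> I" "finite H" "H \<subseteq> I" "F m \<subseteq> G" "F n \<subseteq> H" for G H m n
  proof -
    have "sum c G = sum c (G - H) + sum c (G \<inter> H)" "sum c H = sum c (H - G) + sum c (G \<inter> H)"
      using G by (metis sum.Int_Diff add.commute, metis Int_commute sum.Int_Diff add.commute)
    then have eq: "sum c G - sum c H = sum c (G - H) - sum c (H - G)" by simp
    have "c ` (G - H) \<subseteq> S" "c ` (H - G) \<subseteq> S" using G c by blast+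
    then have in_S: "sum c (G - H) \<in> S" "sum c (H - G) \<in> S" by (auto intro: sum_in_carrier)
    have "N (sum c (G - H) - sum c (H - G)) \<le> N (0 - sum c (G - H)) + N (0 - sum c (H - G))"
      using in_S by (intro norm_triangle_diff subspace_0[OF subspace_carrier]) auto
    also have "\<dots> = N (sum c (G - H)) + N (sum c (H - G))"
      using norm_minus_commute_carrier[OF subspace_0[OF subspace_carrier]] in_S by simp
    also have "\<dots> \<le> (\<Sum>i\<in>G - H. N (c i)) + (\<Sum>i\<in>H - G. N (c i))"
      using G c by (intro add_mono norm_sum_le) blast+
    also have "\<dots> \<le> 1 / (1 + real n) + 1 / (1 + real m)"
      using G by (intro add_mono tail) auto
    finally show ?thesis unfolding eq by simp
  qed
  have in_S: "sum c (F n) \<in> S" for n using F(2) c by (intro sum_in_carrier) auto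
  have "MCauchy (\<lambda>n. sum c (F n))"
    unfolding MCauchy_def
  proof (intro conjI allI impI)
    show "range (\<lambda>n. sum c (F n)) \<subseteq> S" using in_S by auto
    fix \<epsilon> :: real assume "\<epsilon> > 0"
    then obtain M where M: "1 / real (Suc M) < \<epsilon> / 2"
      using nat_approx_posE[of "\<epsilon> / 2"] by auto
    show "\<exists>M. \<forall>n n'. M \<le> n \<longrightarrow> M \<le> n' \<longrightarrow> norm_dist S N (sum c (F n)) (sum c (F n')) < \<epsilon>"
    proof (intro exI[of _ M] allI impI)
      fix n n' assume "M \<le> n" "M \<le> n'"
      then have "1 / (1 + real n) \<le> 1 / real (Suc M)" "1 / (1 + real n') \<le> 1 / real (Suc M)"
        by (auto intro!: divide_left_mono)
      moreover have "N (sum c (F n) - sum c (F n')) \<le> 1 / (1 + real n) + 1 / (1 + real n')"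
        by (rule diff) (use F in auto)
      ultimately show "norm_dist S N (sum c (F n)) (sum c (F n')) < \<epsilon>"
        using in_S M by (simp add: norm_dist_def)
    qed
  qed
  then obtain x where x: "limitin mtopology (\<lambda>n. sum c (F n)) x sequentially"
    using complete unfolding mcomplete_def by blast
  then have xS: "x \<in> S" using limitin_mspace by blast
  have "((\<lambda>G. N (sum c G - x)) \<longlongrightarrow> 0) (finite_subsets_at_top I)"
    unfolding tendsto_iff
  proof (intro allI impI)
    fix \<epsilon> :: real assume "\<epsilon> > 0"
    then obtain M where M: "1 / real (Suc M) < \<epsilon> / 3"
      using nat_approx_posE[of "\<epsilon> / 3"] by auto
    have "\<forall>\<^sub>F n in sequentially. norm_dist S N (sum c (F n)) x < \<epsilon> / 3"
      using x \<open>\<epsilon> > 0\<close> unfolding limitin_metric by (auto elim!: allE[of _ "\<epsilon>/3"] eventually_mono)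
    then obtain n where n: "n \<ge> M" "norm_dist S N (sum c (F n)) x < \<epsilon> / 3"
      unfolding eventually_sequentially by (meson nle_le)
    have small: "1 / (1 + real n) < \<epsilon> / 3"
      using M n by (smt (verit, best) frac_le of_nat_Suc of_nat_0_le_iff of_nat_mono)
    show "\<forall>\<^sub>F G in finite_subsets_at_top I. dist (N (sum c G - x)) 0 < \<epsilon>"
      unfolding eventually_finite_subsets_at_top
    proof (intro exI[of _ "F n"] conjI allI impI F)
      fix G assume G: "finite G \<and> F n \<subseteq> G \<and> G \<subseteq> I"
      have GS: "sum c G \<in> S" using G c by (intro sum_in_carrier) auto
      have "N (sum c G - x) \<le> N (sum c (F n) - sum c G) + N (sum c (F n) - x)"
        by (rule norm_triangle_diff[OF GS xS in_S])
      also have "N (sum c (F n) - sum c G) \<le> 1 / (1 + real n) + 1 / (1 + real n)"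
        by (rule diff) (use F G in auto)
      also have "N (sum c (F n) - x) < \<epsilon> / 3" using n in_S xS by (simp add: norm_dist_def)
      finally show "dist (N (sum c G - x)) 0 < \<epsilon>"
        using small norm_nonneg[OF subspace_diff[OF subspace_carrier GS xS]] by simp
    qed
  qed
  then show ?thesis using xS c summ by (auto simp: abs_sums_def)
qed

text \<open>
  The substitute for Fubini's theorem. Subtracting the sums of finitely many fibres of \<open>p\<close>
  leaves the sum over the other fibres, whose norm is at most a tail of \<open>\<Sum> N (c i)\<close>. With \<open>p\<close> a
  projection this evaluates double series, with \<open>p\<close> a frequency it collects Fourier coefficients.
\<close>

lemma abs_sums_regroup:
  assumes x: "abs_sums c I x" and p: "p ` I \<subseteq> J"
    and y: "\<And>j. j \<in> J \<Longrightarrow> abs_sums c {i \<in> I. p i = j} (y j)"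
  shows "abs_sums y J x" and "(\<Sum>\<^sub>\<infinity>j\<in>J. N (y j)) \<le> (\<Sum>\<^sub>\<infinity>i\<in>I. N (c i))"
proof -
  let ?fib = "\<lambda>j. {i \<in> I. p i = j}"
  let ?u = "\<lambda>j. \<Sum>\<^sub>\<infinity>i\<in>?fib j. N (c i)"
  have c: "c ` I \<subseteq> S" and summ: "(\<lambda>i. N (c i)) summable_on I" and xS: "x \<in> S"
    using x by (auto simp: abs_sums_def)
  have yS: "\<And>j. j \<in> J \<Longrightarrow> y j \<in> S" using y by (auto simp: abs_sums_def)
  have bij: "bij_betw snd (Sigma J ?fib) I"
    using p by (auto simp: bij_betw_def inj_on_def image_def)
  have "((\<lambda>i. N (c i)) has_sum (\<Sum>\<^sub>\<infinity>i\<in>I. N (c i))) I" using summ by simp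
  then have "((\<lambda>z. N (c (snd z))) has_sum (\<Sum>\<^sub>\<infinity>i\<in>I. N (c i))) (Sigma J ?fib)"
    using has_sum_reindex_bij_betw[OF bij, of "\<lambda>i. N (c i)"] by simp
  moreover have "((\<lambda>i. N (c (snd (j, i)))) has_sum ?u j) (?fib j)" if "j \<in> J" for j
    using y[OF that] by (simp add: abs_sums_def)
  ultimately have u: "(?u has_sum (\<Sum>\<^sub>\<infinity>i\<in>I. N (c i))) J"
    by (rule has_sum_SigmaD)
  have Ny: "N (y j) \<le> ?u j" if "j \<in> J" for j
    using abs_sums_norm_le[OF y[OF that]] .
  have summ_y: "(\<lambda>j. N (y j)) summable_on J"
    by (rule summable_on_comparison_test[of ?u])
       (use u Ny yS in \<open>auto simp: has_sum_imp_summable intro!: norm_nonneg\<close>)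
  have "(\<Sum>\<^sub>\<infinity>j\<in>J. N (y j)) \<le> infsum ?u J"
    using summ_y u Ny by (intro infsum_mono) (auto simp: has_sum_imp_summable)
  then show "(\<Sum>\<^sub>\<infinity>j\<in>J. N (y j)) \<le> (\<Sum>\<^sub>\<infinity>i\<in>I. N (c i))" using u by (simp add: infsumI)
  have fin: "abs_sums c {i \<in> I. p i \<in> G} (sum y G)" if "finite G" "G \<subseteq> J" for G
    using that
  proof (induction G rule: finite_induct)
    case empty
    then show ?case using abs_sums_finite[of "{}" c] by simp
  next
    case (insert j G)
    have "abs_sums c ({i \<in> I. p i = j} \<union> {i \<in> I. p i \<in> G}) (y j + sum y G)"
      using insert by (intro abs_sums_Un y) auto
    moreover have "{i \<in> I. p i = j} \<union> {i \<in> I. p i \<in> G} = {i \<in> I. p i \<in> insert j G}" by auto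
    ultimately show ?case using insert by simp
  qed
  have "((\<lambda>G. N (sum y G - x)) \<longlongrightarrow> 0) (finite_subsets_at_top J)"
  proof (rule Lim_null_comparison)
    have "((\<lambda>G. infsum ?u J - sum ?u G) \<longlongrightarrow> infsum ?u J - infsum ?u J) (finite_subsets_at_top J)"
      using u by (intro tendsto_intros infsum_tendsto) (auto simp: has_sum_imp_summable)
    then show "((\<lambda>G. infsum ?u J - sum ?u G) \<longlongrightarrow> 0) (finite_subsets_at_top J)" by simp
    show "\<forall>\<^sub>F G in finite_subsets_at_top J. norm (N (sum y G - x)) \<le> infsum ?u J - sum ?u G"
    proof (rule eventually_finite_subsets_at_top_weakI)
      fix G assume G: "finite G" "G \<subseteq> J"
      let ?R = "{i \<in> I. p i \<notin> G}"
      have sub: "(\<lambda>i. N (c i)) summable_on ?R" "(\<lambda>i. N (c i)) summable_on {i \<in> I. p i \<in> G}"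
        using summ by (auto intro: summable_on_subset)
      obtain z where z: "abs_sums c ?R z"
        using abs_sums_exists[of c ?R] c sub by auto
      have "abs_sums c ({i \<in> I. p i \<in> G} \<union> ?R) (sum y G + z)"
        by (intro abs_sums_Un fin z G) auto
      moreover have "{i \<in> I. p i \<in> G} \<union> ?R = I" by auto
      ultimately have eq: "x = sum y G + z" using abs_sums_unique[OF x] by simp
      have "N (sum y G - x) = N (x - sum y G)"
        using norm_minus_commute_carrier xS fin[OF G] by (auto simp: abs_sums_def)
      also have "\<dots> = N z" using eq by simp
      also have "\<dots> \<le> (\<Sum>\<^sub>\<infinity>i\<in>?R. N (c i))" by (rule abs_sums_norm_le[OF z])
      also have "\<dots> = (\<Sum>\<^sub>\<infinity>i\<in>I. N (c i)) - (\<Sum>\<^sub>\<infinity>i\<in>{i \<in> I. p i \<in> G}. N (c i))"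
      proof -
        have "(\<Sum>\<^sub>\<infinity>i\<in>{i \<in> I. p i \<in> G} \<union> ?R. N (c i)) =
            (\<Sum>\<^sub>\<infinity>i\<in>{i \<in> I. p i \<in> G}. N (c i)) + (\<Sum>\<^sub>\<infinity>i\<in>?R. N (c i))"
          using sub by (intro infsum_Un_disjoint) auto
        then show ?thesis using \<open>{i \<in> I. p i \<in> G} \<union> ?R = I\<close> by simp
      qed
      also have "(\<Sum>\<^sub>\<infinity>i\<in>{i \<in> I. p i \<in> G}. N (c i)) = sum ?u G"
      proof -
        have "sum ?u G = infsum (\<lambda>i. N (c i)) (\<Union>j\<in>G. ?fib j)"
          using G summ by (intro sum_infsum) (auto intro: summable_on_subset)
        moreover have "(\<Union>j\<in>G. ?fib j) = {i \<in> I. p i \<in> G}" by auto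
        ultimately show ?thesis by simp
      qed
      also have "(\<Sum>\<^sub>\<infinity>i\<in>I. N (c i)) = infsum ?u J" using u by (simp add: infsumI)
      finally have "N (sum y G - x) \<le> infsum ?u J - sum ?u G" .
      moreover have "0 \<le> N (sum y G - x)"
        using xS fin[OF G] by (intro norm_nonneg subspace_diff[OF subspace_carrier]) (auto simp: abs_sums_def)
      ultimately show "norm (N (sum y G - x)) \<le> infsum ?u J - sum ?u G" by simp
    qed
  qed
  then show "abs_sums y J x" using yS summ_y xS by (auto simp: abs_sums_def)
qed

end

section \<open>The dilogarithm on the unit circle\<close>

definition dilog :: "complex \<Rightarrow> complex" where
  "dilog z = (\<Sum>n. 1 / of_nat n ^ 2 * z ^ n)"

lemma summable_norm_dilog:
  assumes "norm z \<le> 1"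
  shows "summable (\<lambda>n. norm (1 / of_nat n ^ 2 * z ^ n :: complex))"
proof (rule summable_comparison_test')
  show "summable (\<lambda>n. inverse (real n ^ 2))" by (rule inverse_power_summable) simp
  show "norm (norm (1 / of_nat n ^ 2 * z ^ n :: complex)) \<le> inverse (real n ^ 2)" for n
    using power_le_one[of "norm z" n] assms
    by (simp add: norm_mult norm_divide norm_power divide_simps)
qed

lemma continuous_on_dilog: "continuous_on (cball 0 1) dilog"
proof (rule uniform_limit_theorem)
  show "uniform_limit (cball 0 1) (\<lambda>n z. \<Sum>i<n. 1 / of_nat i ^ 2 * z ^ i) dilog sequentially"
    unfolding dilog_def[abs_def]
  proof (rule Weierstrass_m_test)
    show "summable (\<lambda>n. inverse (real n ^ 2))" by (rule inverse_power_summable) simp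
    show "norm (1 / of_nat n ^ 2 * z ^ n :: complex) \<le> inverse (real n ^ 2)" if "z \<in> cball 0 1" for n z
      using power_le_one[of "norm z" n] that
      by (simp add: norm_mult norm_divide norm_power divide_simps)
  qed
next
  show "\<forall>\<^sub>F n in sequentially. continuous_on (cball 0 1) (\<lambda>z :: complex. \<Sum>i<n. 1 / of_nat i ^ 2 * z ^ i)"
    by (intro always_eventually allI continuous_intros)
qed simp

text \<open>
  The derivative is \<open>- Ln (1 - z) / z\<close>; multiplying by \<open>z\<close> avoids the removable singularity,
  and only this product occurs in the derivative along a circle.
\<close>

lemma dilog_has_field_derivative:
  assumes "norm z < 1"
  obtains D where "(dilog has_field_derivative D) (at z)" "z * D = - Ln (1 - z)"
proof
  let ?c = "\<lambda>n. 1 / of_nat n ^ 2 :: complex"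
  let ?D = "\<Sum>n. diffs ?c n * z ^ n"
  have "summable (\<lambda>n. ?c n * 1 ^ n)"
    using summable_norm_cancel[OF summable_norm_dilog[of 1]] by simp
  then show "(dilog has_field_derivative ?D) (at z)"
    unfolding dilog_def[abs_def] using assms by (intro termdiffs_strong[where K = 1]) auto
  have diffs: "diffs ?c n = 1 / of_nat (Suc n)" for n
    unfolding diffs_def power2_eq_square by (simp del: of_nat_Suc)
  have "summable (\<lambda>n. diffs ?c n * z ^ n)"
  proof (rule summable_comparison_test')
    show "summable (\<lambda>n. norm z ^ n)" using assms by (intro summable_geometric) auto
    show "norm (diffs ?c n * z ^ n) \<le> norm z ^ n" for n
    proof -
      have "norm (diffs ?c n * z ^ n) = norm z ^ n / real (Suc n)"
        unfolding diffs by (simp add: norm_mult norm_divide norm_power del: of_nat_Suc)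
      also have "\<dots> \<le> norm z ^ n / 1" by (intro divide_left_mono) auto
      finally show ?thesis by simp
    qed
  qed
  then have "(\<lambda>n. - z * (diffs ?c n * z ^ n)) sums (- z * ?D)"
    by (intro sums_mult summable_sums)
  moreover have "(\<lambda>n. - z * (diffs ?c n * z ^ n)) = (\<lambda>n. - (z ^ Suc n) / of_nat (Suc n))"
    unfolding diffs by (rule ext) (simp del: of_nat_Suc)
  moreover have "(\<lambda>n. - ((- (-z)) ^ n) / of_nat n) sums Ln (1 + - z)"
    using assms by (intro Ln_series') auto
  then have "(\<lambda>n. - (z ^ Suc n) / of_nat (Suc n)) sums Ln (1 - z)"
    using sums_Suc_iff[of "\<lambda>n. - ((- (-z)) ^ n) / of_nat n" "Ln (1 - z)"] by (simp del: of_nat_Suc)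
  ultimately have "- z * ?D = Ln (1 - z)" using sums_unique2 by simp
  then show "z * ?D = - Ln (1 - z)" by (simp add: minus_equation_iff[of _ "Ln _"])
qed

text \<open>
  \<open>1 - exp (i t) = 2 sin (t / 2) exp (i (t - pi) / 2)\<close>.
\<close>

lemma Im_Ln_one_minus_exp:
  assumes "0 < t" "t < 2 * pi"
  shows "Im (Ln (1 - exp (\<i> * of_real t))) = (t - pi) / 2"
proof -
  have s: "sin (t / 2) > 0" using assms by (intro sin_gt_zero) auto
  let ?w = "of_real (ln (2 * sin (t / 2))) + \<i> * of_real ((t - pi) / 2)"
  have c: "cos ((t - pi) / 2) = sin (t / 2)" "sin ((t - pi) / 2) = - cos (t / 2)"
    by (simp_all add: diff_divide_distrib cos_diff sin_diff)
  have "cos t = 1 - 2 * sin (t / 2) ^ 2" "sin t = 2 * sin (t / 2) * cos (t / 2)"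
    using cos_double_sin[of "t / 2"] sin_double[of "t / 2"] by auto
  then have "exp ?w = 1 - exp (\<i> * of_real t)"
    using s unfolding exp_add exp_of_real cis_conv_exp[symmetric]
    by (simp add: complex_eq_iff c power2_eq_square)
  then have "Ln (1 - exp (\<i> * of_real t)) = ?w"
    using assms by (intro Ln_unique) auto
  then show ?thesis by simp
qed

lemma Re_dilog_circle_has_derivative:
  assumes "0 \<le> r" "r < 1"
  shows "((\<lambda>t. Re (dilog (of_real r * exp (\<i> * of_real t)))) has_real_derivative
      Im (Ln (1 - of_real r * exp (\<i> * of_real t)))) (at t)"
proof -
  let ?z = "\<lambda>w. of_real r * exp (\<i> * w)"
  have "norm (?z (of_real t)) < 1" using assms by (simp add: norm_mult)
  then obtain D where D: "(dilog has_field_derivative D) (at (?z (of_real t)))"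
    "?z (of_real t) * D = - Ln (1 - ?z (of_real t))"
    using dilog_has_field_derivative by blast
  have "((\<lambda>w. dilog (?z w)) has_field_derivative D * (?z (of_real t) * \<i>)) (at (of_real t))"
    by (rule DERIV_chain2[where f = dilog and g = ?z, OF D(1)]) (auto intro!: derivative_eq_intros)
  also have "D * (?z (of_real t) * \<i>) = - \<i> * Ln (1 - ?z (of_real t))"
    using D(2) by (metis (no_types, lifting) mult.assoc mult.commute mult_minus_left mult_minus_right)
  finally have "((\<lambda>u. dilog (?z (of_real u))) has_vector_derivative - \<i> * Ln (1 - ?z (of_real t))) (at t)"
    by (rule has_vector_derivative_real_field)
  from bounded_linear.has_vector_derivative[OF bounded_linear_Re this]
  show ?thesis by (simp add: has_real_derivative_iff_has_vector_derivative)
qed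

text \<open>
  On the circle of radius \<open>r < 1\<close> the angular derivative of \<open>Re dilog\<close> is \<open>Im (Ln (1 - r e\<^sup>i\<^sup>t))\<close>.
  As \<open>r\<close> tends to 1, this tends to \<open>(t - pi) / 2\<close> uniformly on compact subintervals of
  \<open>(0, 2 pi)\<close>, and the quadratic is chosen to cancel this limit. Constancy passes to the limit because
  \<open>dilog\<close> is continuous on the closed disc.
\<close>

lemma Re_dilog_circle_minus_quadratic_const:
  assumes ab: "0 < a" "a < b" "b < 2 * pi"
  defines "f \<equiv> \<lambda>r t. Re (dilog (of_real r * exp (\<i> * of_real t))) + pi * t / 2 - t\<^sup>2 / 4"
  shows "f 1 a = f 1 b"
proof -
  define h where "h = (\<lambda>(r :: real, t :: real). Im (Ln (1 - of_real r * exp (\<i> * of_real t))) + pi / 2 - t / 2)"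
  let ?K = "{0..1} \<times> {a..b}"
  have Re_pos: "0 < Re (1 - of_real r * exp (\<i> * of_real t))" if "r \<in> {0..1}" "t \<in> {a..b}" for r t :: real
  proof -
    have "0 < sin (t / 2)" using that ab by (intro sin_gt_zero) auto
    then have "cos t < 1" using cos_double_sin[of "t / 2"] by simp
    have "r * cos t < 1"
    proof (cases "0 \<le> cos t")
      case True
      then have "r * cos t \<le> 1 * cos t" using that by (intro mult_right_mono) auto
      then show ?thesis using \<open>cos t < 1\<close> by simp
    next
      case False
      then have "r * cos t \<le> 0" using that by (intro mult_nonneg_nonpos) auto
      then show ?thesis by simp
    qed
    then show ?thesis by (simp add: Re_exp)
  qed
  have "continuous_on ?K h"
    unfolding h_def case_prod_unfold
  proof (intro continuous_on_add continuous_on_diff continuous_on_Im continuous_on_Ln')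
    fix p :: "real \<times> real" assume "p \<in> ?K"
    then have "0 < Re (1 - of_real (fst p) * exp (\<i> * of_real (snd p)))"
      by (intro Re_pos) auto
    then show "1 - of_real (fst p) * exp (\<i> * of_real (snd p)) \<notin> \<real>\<^sub>\<le>\<^sub>0"
      unfolding complex_nonpos_Reals_iff by linarith
  qed (auto intro!: continuous_intros)
  then have uc: "uniformly_continuous_on ?K h"
    by (intro compact_uniformly_continuous compact_Times) auto
  have cont: "continuous_on {0..1} (\<lambda>r. f r t)" for t
    unfolding f_def
    by (intro continuous_intros continuous_on_compose2[OF continuous_on_dilog]) (auto simp: norm_mult)
  have bound: "\<bar>f 1 a - f 1 b\<bar> \<le> e * (b - a)" if e: "e > 0" for e
  proof -
    obtain d where d: "d > 0" "\<forall>x\<in>?K. \<forall>y\<in>?K. dist y x < d \<longrightarrow> dist (h y) (h x) < e"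
      using uc[unfolded uniformly_continuous_on_def, rule_format, OF e] by blast
    have near: "\<bar>f r a - f r b\<bar> \<le> e * (b - a)" if r: "0 \<le> r" "r < 1" "1 - r < d" for r
    proof -
      have "norm (f r a - f r b) \<le> e * norm (a - b)"
      proof (rule field_differentiable_bound[of "{a..b}"])
        fix t assume t: "t \<in> {a..b}"
        show "(f r has_field_derivative h (r, t)) (at t within {a..b})"
          unfolding f_def h_def prod.case
          by (intro DERIV_diff DERIV_add Re_dilog_circle_has_derivative[THEN has_field_derivative_at_within] r)
             (auto intro!: derivative_eq_intros)
        have "dist (h (r, t)) (h (1, t)) < e"
          using r t by (intro d(2)[rule_format]) (auto simp: dist_Pair_Pair dist_real_def)
        moreover have "h (1, t) = 0" using t ab Im_Ln_one_minus_exp[of t] by (simp add: h_def field_simps)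
        ultimately show "norm (h (r, t)) \<le> e" by simp
      qed (use ab in auto)
      then show ?thesis using ab by simp
    qed
    have lim: "((\<lambda>r. f r t) \<longlongrightarrow> f 1 t) (at 1 within {0..1})" for t
      using cont[of t] unfolding continuous_on_def by auto
    have "((\<lambda>r. \<bar>f r a - f r b\<bar>) \<longlongrightarrow> \<bar>f 1 a - f 1 b\<bar>) (at 1 within {0..1})"
      by (intro tendsto_intros lim)
    moreover have "\<forall>\<^sub>F r in at 1 within {0..1}. \<bar>f r a - f r b\<bar> \<le> e * (b - a)"
      unfolding eventually_at using d(1) near
      by (intro exI[of _ d]) (auto simp: dist_real_def)
    moreover have "at (1::real) within {0..1} \<noteq> bot"
      by (simp add: trivial_limit_within islimpt_Icc)
    ultimately show ?thesis by (rule tendsto_upperbound)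
  qed
  have "\<bar>f 1 a - f 1 b\<bar> \<le> 0 + e" if "e > 0" for e
    using bound[of "e / (b - a)"] that ab by simp
  then have "\<bar>f 1 a - f 1 b\<bar> \<le> 0" by (rule field_le_epsilon)
  then show ?thesis by simp
qed

lemma dilog_1: "dilog 1 = of_real (pi\<^sup>2 / 6)"
proof -
  have "(\<lambda>n. of_real (1 / (real n + 1)\<^sup>2) :: complex) sums of_real (pi\<^sup>2 / 6)"
    using inverse_squares_sums by (intro sums_of_real) (simp add: add.commute)
  then have "(\<lambda>n. 1 / of_nat (Suc n) ^ 2 * 1 ^ Suc n :: complex) sums of_real (pi\<^sup>2 / 6)"
    by (simp add: add.commute)
  then have "(\<lambda>n. 1 / of_nat n ^ 2 * 1 ^ n :: complex) sums of_real (pi\<^sup>2 / 6)"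
    by (subst (asm) sums_Suc_iff) simp
  then show ?thesis unfolding dilog_def by (rule sums_unique[symmetric])
qed

text \<open>
  Up to scaling, the Fourier expansion of the second periodic Bernoulli polynomial.
\<close>

lemma Re_dilog_circle:
  assumes "\<bar>t\<bar> \<le> 2 * pi"
  shows "Re (dilog (exp (\<i> * of_real t))) = pi\<^sup>2 / 6 - pi * \<bar>t\<bar> / 2 + t\<^sup>2 / 4"
proof -
  define f where "f = (\<lambda>t. Re (dilog (exp (\<i> * of_real t))) + pi * t / 2 - t\<^sup>2 / 4)"
  have S: "closure {0<..<2 * pi} = {0..2 * pi}" by simp
  have cont: "continuous_on (closure {0<..<2 * pi}) f"
    unfolding f_def
    by (intro continuous_intros continuous_on_compose2[OF continuous_on_dilog]) auto
  have const: "f x = f pi" if "x \<in> {0<..<2 * pi}" for x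
    using that Re_dilog_circle_minus_quadratic_const[of x pi] Re_dilog_circle_minus_quadratic_const[of pi x]
    by (cases x pi rule: linorder_cases) (auto simp: f_def)
  have eq: "f x = f pi" if "x \<in> {0..2 * pi}" for x
    using continuous_constant_on_closure[OF cont const] that unfolding S by blast
  have "f \<bar>t\<bar> = f 0" using eq[of "\<bar>t\<bar>"] eq[of 0] assms by simp
  also have "\<dots> = pi\<^sup>2 / 6"
    using arg_cong[OF dilog_1, of Re] unfolding Re_complex_of_real by (simp add: f_def)
  finally have *: "Re (dilog (exp (\<i> * of_real \<bar>t\<bar>))) = pi\<^sup>2 / 6 - pi * \<bar>t\<bar> / 2 + t\<^sup>2 / 4"
    by (simp add: f_def algebra_simps)
  have cnj: "dilog (cnj z) = cnj (dilog z)" if "norm z \<le> 1" for z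
  proof -
    have "(\<lambda>n. 1 / of_nat n ^ 2 * z ^ n) sums dilog z"
      unfolding dilog_def using summable_norm_cancel[OF summable_norm_dilog[OF that]] by (intro summable_sums)
    then have "(\<lambda>n. cnj (1 / of_nat n ^ 2 * z ^ n)) sums cnj (dilog z)" by (simp only: sums_cnj)
    then show ?thesis unfolding dilog_def by (simp add: sums_iff)
  qed
  show ?thesis
  proof (cases "t \<ge> 0")
    case False
    have "exp (\<i> * of_real t) = cnj (exp (\<i> * of_real \<bar>t\<bar>))" using False by (simp add: exp_cnj)
    then have "Re (dilog (exp (\<i> * of_real t))) = Re (dilog (exp (\<i> * of_real \<bar>t\<bar>)))"
      using cnj[of "exp (\<i> * of_real \<bar>t\<bar>)"] by simp
    then show ?thesis using * by simp
  qed (use * in simp)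
qed

section \<open>Triangle functions and their Fourier coefficients\<close>

abbreviation harmonic :: "int \<Rightarrow> real \<Rightarrow> complex" where
  "harmonic n t \<equiv> exp (\<i> * of_int n * of_real t)"

lemma norm_harmonic: "norm (harmonic n t) = 1"
proof -
  have "harmonic n t = exp (\<i> * of_real (of_int n * t))" by (simp add: mult.assoc)
  then show ?thesis by (simp only: norm_exp_i_times)
qed

lemma harmonic_add: "harmonic (m + n) t = harmonic m t * harmonic n t"
  by (simp add: algebra_simps flip: exp_add)

lemma harmonic_add_arg: "harmonic n (s + t) = harmonic n s * harmonic n t"
  by (simp add: algebra_simps flip: exp_add)

lemma harmonic_2pi: "harmonic n (2 * pi * of_int k) = 1"
proof -
  have "harmonic n (2 * pi * of_int k) = exp (of_int (2 * (n * k)) * of_real pi * \<i>)"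
    by (simp add: algebra_simps)
  also have "\<dots> = 1" unfolding exp_eq_1 by (intro conjI exI[of _ "n * k"]) simp_all
  finally show ?thesis .
qed

lemma harmonic_periodic: "harmonic n (t + 2 * pi * of_int k) = harmonic n t"
  by (simp add: harmonic_add_arg[of n t "2 * pi * of_int k"] harmonic_2pi[simplified] del: of_real_add)

lemma harmonic_plus_minus: "harmonic k t + harmonic k (- t) = 2 * of_real (cos (of_int k * t))"
proof -
  have "harmonic k t = cis (of_int k * t)" "harmonic k (- t) = cis (- (of_int k * t))"
    by (simp_all add: cis_conv_exp mult.assoc)
  then show ?thesis by (simp add: complex_eq_iff)
qed

lemma has_sum_int:
  fixes u :: "int \<Rightarrow> 'b :: real_normed_vector"
  assumes "((\<lambda>n. u (int (Suc n))) has_sum A) UNIV" "((\<lambda>n. u (- int (Suc n))) has_sum B) UNIV"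
  shows "(u has_sum (u 0 + A + B)) UNIV"
proof -
  have "(u has_sum A) (range (\<lambda>n. int (Suc n)))"
    using assms(1) by (subst has_sum_reindex) (auto simp: inj_on_def o_def)
  moreover have "(u has_sum B) (range (\<lambda>n. - int (Suc n)))"
    using assms(2) by (subst has_sum_reindex) (auto simp: inj_on_def o_def)
  moreover have "(u has_sum u 0) {0}" by (rule has_sum_finiteI) auto
  ultimately have "(u has_sum (u 0 + A + B)) ({0} \<union> range (\<lambda>n. int (Suc n)) \<union> range (\<lambda>n. - int (Suc n)))"
    by (intro has_sum_Un_disjoint) auto
  moreover have "k \<in> {0} \<union> range (\<lambda>n. int (Suc n)) \<union> range (\<lambda>n. - int (Suc n))" for k
  proof (cases k rule: int_cases3)
    case (pos n) then show ?thesis by (auto intro!: image_eqI[of _ _ "n - 1"])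
  next
    case (neg n) then show ?thesis by (auto intro!: image_eqI[of _ _ "n - 1"])
  qed simp
  then have "{0} \<union> range (\<lambda>n. int (Suc n)) \<union> range (\<lambda>n. - int (Suc n)) = UNIV" by blast
  ultimately show ?thesis by simp
qed

text \<open>
  The term with index 0 vanishes because division by zero is zero.
\<close>

lemma quadratic_has_sum:
  assumes "\<bar>t\<bar> \<le> 2 * pi"
  shows "((\<lambda>k. 1 / of_int k ^ 2 * harmonic k t) has_sum
      of_real (pi\<^sup>2 / 3 - pi * \<bar>t\<bar> + t\<^sup>2 / 2)) UNIV"
proof -
  let ?z = "exp (\<i> * of_real t)"
  let ?g = "\<lambda>n. 1 / of_nat n ^ 2 * ?z ^ n"
  have norm: "norm ?z \<le> 1" by simp
  have summ: "summable (\<lambda>n. norm (?g (Suc n)))"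
    using summable_norm_dilog[OF norm] by (subst summable_Suc_iff)
  have "?g sums dilog ?z"
    unfolding dilog_def using summable_norm_cancel[OF summable_norm_dilog[OF norm]]
    by (rule summable_sums)
  then have "(\<lambda>n. ?g (Suc n)) sums dilog ?z"
    by (subst sums_Suc_iff) simp
  with summ have A: "((\<lambda>n. ?g (Suc n)) has_sum dilog ?z) UNIV"
    by (rule norm_summable_imp_has_sum)
  have g: "?g (Suc n) = 1 / of_int (int (Suc n)) ^ 2 * harmonic (int (Suc n)) t" for n
    by (simp add: exp_of_nat_mult[symmetric] exp_add[symmetric] algebra_simps)
  have "cnj (?g (Suc n)) = 1 / of_int (- int (Suc n)) ^ 2 * harmonic (- int (Suc n)) t" for n
    unfolding g by (simp add: exp_cnj del: of_nat_Suc)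
  moreover have "((\<lambda>n. cnj (?g (Suc n))) has_sum cnj (dilog ?z)) UNIV" using A by (simp only: has_sum_cnj_iff)
  ultimately have B: "((\<lambda>n. 1 / of_int (- int (Suc n)) ^ 2 * harmonic (- int (Suc n)) t)
      has_sum cnj (dilog ?z)) UNIV" by simp
  have "((\<lambda>k. 1 / of_int k ^ 2 * harmonic k t) has_sum
     (1 / of_int 0 ^ 2 * harmonic 0 t + dilog ?z + cnj (dilog ?z))) UNIV"
    by (rule has_sum_int[OF A[unfolded g] B])
  moreover have "1 / of_int 0 ^ 2 * harmonic 0 t + dilog ?z + cnj (dilog ?z) =
      of_real (2 * Re (dilog ?z))"
    by (simp add: complex_add_cnj)
  moreover have "2 * Re (dilog ?z) = pi\<^sup>2 / 3 - pi * \<bar>t\<bar> + t\<^sup>2 / 2"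
    unfolding Re_dilog_circle[OF assms] by (simp add: algebra_simps)
  ultimately show ?thesis by (simp only:)
qed

text \<open>
  The Fourier coefficients of the triangle function with peak 1 at 0 and half-width \<open>d\<close>.
\<close>

definition triangle_coeff :: "real \<Rightarrow> int \<Rightarrow> real" where
  "triangle_coeff d k = (if k = 0 then d / (2 * pi) else (1 - cos (of_int k * d)) / (pi * d * of_int k ^ 2))"

lemma triangle_coeff_minus: "triangle_coeff d (- k) = triangle_coeff d k"
  by (simp add: triangle_coeff_def)

lemma triangle_coeff_nonneg: "0 < d \<Longrightarrow> 0 \<le> triangle_coeff d k"
  by (simp add: triangle_coeff_def)

text \<open>
  The function \<open>(1 - cos (k d)) / k\<^sup>2 * exp (i k t)\<close> of \<open>t\<close> is half the negated second difference,
  with step \<open>d\<close>, of \<open>exp (i k t) / k\<^sup>2\<close>. Hence the series is a second difference of the function in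
  \<open>quadratic_has_sum\<close>, in which only the term \<open>- pi * \<bar>t\<bar>\<close> is not smooth at 0.
  The coefficient with index 0 cancels the constant left by the square.
\<close>

lemma triangle_has_sum:
  assumes d: "0 < d" "d \<le> pi" and t: "\<bar>t\<bar> \<le> pi"
  shows "((\<lambda>k. of_real (triangle_coeff d k) * harmonic k t) has_sum
      of_real (max 0 (1 - \<bar>t\<bar> / d))) UNIV"
proof -
  define q where "q = (\<lambda>t. pi\<^sup>2 / 3 - pi * \<bar>t\<bar> + t\<^sup>2 / 2)"
  let ?E = "\<lambda>t k. 1 / of_int k ^ 2 * harmonic k t"
  have E: "(?E s has_sum of_real (q s)) UNIV" if "\<bar>s\<bar> \<le> 2 * pi" for s
    using quadratic_has_sum[OF that] by (simp add: q_def)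
  have "((\<lambda>k. ?E t k + of_real (-1/2) * (?E (t + d) k + ?E (t + - d) k)) has_sum
      (of_real (q t) + of_real (-1/2) * (of_real (q (t + d)) + of_real (q (t + - d))))) UNIV"
    using t d by (intro has_sum_add has_sum_cmult_right E) auto
  then have "((\<lambda>k. of_real (1 / (pi * d)) * (?E t k + of_real (-1/2) * (?E (t + d) k + ?E (t + - d) k))) has_sum
      (of_real (1 / (pi * d)) * (of_real (q t) + of_real (-1/2) * (of_real (q (t + d)) + of_real (q (t + - d)))))) UNIV"
    by (rule has_sum_cmult_right)
  moreover have "((\<lambda>k. of_real (if k = 0 then d / (2 * pi) else 0) :: complex) has_sum of_real (d / (2 * pi))) (UNIV :: int set)"
    by (rule has_sum_finite_neutralI[of "{0}"]) auto
  ultimately have "((\<lambda>k. of_real (1 / (pi * d)) * (?E t k + of_real (-1/2) * (?E (t + d) k + ?E (t + - d) k)) +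
       of_real (if k = 0 then d / (2 * pi) else 0)) has_sum
      (of_real (1 / (pi * d)) * (of_real (q t) + of_real (-1/2) * (of_real (q (t + d)) + of_real (q (t + - d)))) +
       of_real (d / (2 * pi)))) UNIV"
    by (rule has_sum_add)
  also have "of_real (1 / (pi * d)) * (of_real (q t) + of_real (-1/2) * (of_real (q (t + d)) + of_real (q (t + - d)))) +
       of_real (d / (2 * pi)) = (of_real (max 0 (1 - \<bar>t\<bar> / d)) :: complex)"
  proof -
    have "1 / (pi * d) * (q t - (q (t + d) + q (t + - d)) / 2) + d / (2 * pi) =
        (\<bar>t + d\<bar> + \<bar>t - d\<bar> - 2 * \<bar>t\<bar>) / (2 * d)"
      using d by (simp add: q_def divide_simps) (simp add: algebra_simps power2_eq_square)
    also have "\<dots> = max 0 (1 - \<bar>t\<bar> / d)"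
      using d by (auto simp: max_def abs_if divide_simps)
    finally have *: "1 / (pi * d) * (q t - (q (t + d) + q (t + - d)) / 2) + d / (2 * pi) = max 0 (1 - \<bar>t\<bar> / d)" .
    show ?thesis
      unfolding of_real_add[symmetric] of_real_mult[symmetric] of_real_eq_iff *[symmetric] by simp
  qed
  also have "(\<lambda>k. of_real (1 / (pi * d)) * (?E t k + of_real (-1/2) * (?E (t + d) k + ?E (t + - d) k)) +
       of_real (if k = 0 then d / (2 * pi) else 0)) = (\<lambda>k. of_real (triangle_coeff d k) * harmonic k t)"
  proof
    fix k
    show "of_real (1 / (pi * d)) * (?E t k + of_real (-1/2) * (?E (t + d) k + ?E (t + - d) k)) +
       of_real (if k = 0 then d / (2 * pi) else 0) = of_real (triangle_coeff d k) * harmonic k t"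
    proof (cases "k = 0")
      case False
      have "?E (t + d) k + ?E (t + - d) k = 1 / of_int k ^ 2 * harmonic k t * (harmonic k d + harmonic k (- d))"
        unfolding harmonic_add_arg by (simp only: distrib_left mult.assoc)
      then have *: "?E (t + d) k + ?E (t + - d) k = 1 / of_int k ^ 2 * harmonic k t * (2 * of_real (cos (of_int k * d)))"
        unfolding harmonic_plus_minus .
      show ?thesis unfolding * using False d
        by (simp add: triangle_coeff_def divide_simps) (simp add: algebra_simps)
    qed (simp add: triangle_coeff_def)
  qed
  finally show ?thesis .
qed

lemma triangle_coeff_has_sum_1:
  assumes "0 < d" "d \<le> pi"
  shows "(triangle_coeff d has_sum 1) UNIV"
proof -
  have "((\<lambda>k. of_real (triangle_coeff d k) :: complex) has_sum of_real 1) UNIV"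
    using triangle_has_sum[of d 0] assms by simp
  then show ?thesis by (simp only: has_sum_of_real_iff)
qed

lemma has_sum_finite_sum:
  fixes f :: "'j \<Rightarrow> 'k \<Rightarrow> 'b :: real_normed_vector"
  assumes "finite J" "\<And>j. j \<in> J \<Longrightarrow> (f j has_sum s j) A"
  shows "((\<lambda>x. \<Sum>j\<in>J. f j x) has_sum (\<Sum>j\<in>J. s j)) A"
  using assms by (induction J rule: finite_induct) (auto intro: has_sum_add)

lemma fourier_has_sum:
  assumes "(\<lambda>k. \<bar>p k\<bar>) summable_on UNIV"
  shows "((\<lambda>k. of_real (p k) * harmonic k t) has_sum (\<Sum>\<^sub>\<infinity>k. of_real (p k) * harmonic k t)) UNIV"
proof -
  have "(\<lambda>k. norm (of_real (p k) * harmonic k t)) summable_on UNIV"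
    using assms unfolding norm_mult norm_harmonic by simp
  then have "(\<lambda>k. of_real (p k) * harmonic k t) summable_on UNIV" by (rule abs_summable_summable)
  then show ?thesis by (rule has_sum_infsum)
qed

text \<open>
  Summing over the translates multiplies the coefficient with index \<open>k\<close> by a sum of powers of
  an \<open>m\<close>-th root of unity. This sum vanishes unless the root is 1, and then \<open>cos (k d) = 1\<close> makes
  the coefficient vanish, except for \<open>k = 0\<close>.
\<close>

lemma triangle_partition_of_unity:
  assumes m: "m \<ge> 2"
  shows "(\<Sum>j<m. \<Sum>\<^sub>\<infinity>k. of_real (triangle_coeff (2 * pi / real m) k) * harmonic k (t - 2 * pi * real j / real m)) = 1"
proof -
  define d where "d = 2 * pi / real m"
  have d: "0 < d" "d \<le> pi" using m by (auto simp: d_def field_simps)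
  have summ: "(\<lambda>k. \<bar>triangle_coeff d k\<bar>) summable_on UNIV"
    using triangle_coeff_has_sum_1[OF d] triangle_coeff_nonneg[OF d(1)] has_sum_imp_summable by auto
  have "((\<lambda>k. \<Sum>j<m. of_real (triangle_coeff d k) * harmonic k (t - 2 * pi * real j / real m)) has_sum
     (\<Sum>j<m. \<Sum>\<^sub>\<infinity>k. of_real (triangle_coeff d k) * harmonic k (t - 2 * pi * real j / real m))) UNIV"
    by (intro has_sum_finite_sum fourier_has_sum summ) simp
  moreover have "((\<lambda>k. \<Sum>j<m. of_real (triangle_coeff d k) * harmonic k (t - 2 * pi * real j / real m)) has_sum 1) UNIV"
  proof (rule has_sum_finite_neutralI[of "{0}"])
    fix k :: int assume "k \<in> UNIV - {0}"
    then have k: "k \<noteq> 0" by simp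
    define w where "w = harmonic k (- d)"
    have w: "harmonic k (t - 2 * pi * real j / real m) = harmonic k t * w ^ j" for j
    proof -
      have "t - 2 * pi * real j / real m = t + real j * (- d)" by (simp add: d_def)
      moreover have "w ^ j = harmonic k (real j * (- d))"
        unfolding w_def exp_of_nat_mult[symmetric] by (simp add: algebra_simps)
      ultimately show ?thesis by (simp only: harmonic_add_arg)
    qed
    have "w ^ m = harmonic k (2 * pi * of_int (-1))"
      unfolding w_def exp_of_nat_mult[symmetric] using m by (simp add: d_def algebra_simps)
    then have wm: "w ^ m = 1" by (simp only: harmonic_2pi)
    show "(\<Sum>j<m. of_real (triangle_coeff d k) * harmonic k (t - 2 * pi * real j / real m)) = 0"
    proof (cases "w = 1")
      case True
      have "w = cis (- (of_int k * d))" by (simp add: w_def cis_conv_exp mult.assoc)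
      then have "cos (of_int k * d) = 1" using True by (simp add: complex_eq_iff)
      then show ?thesis using k by (simp add: triangle_coeff_def)
    next
      case False
      have "(\<Sum>j<m. of_real (triangle_coeff d k) * harmonic k (t - 2 * pi * real j / real m)) =
        of_real (triangle_coeff d k) * harmonic k t * (\<Sum>j<m. w ^ j)"
        unfolding w by (simp only: sum_distrib_left mult.assoc)
      also have "(\<Sum>j<m. w ^ j) = 0" using False wm by (simp add: geometric_sum)
      finally show ?thesis by simp
    qed
  qed (use m in \<open>simp_all add: triangle_coeff_def d_def\<close>)
  ultimately show ?thesis unfolding d_def by (rule has_sum_unique)
qed

lemma one_minus_cos_le:
  fixes y :: real assumes "0 \<le> y" shows "1 - cos (y\<^sup>2) \<le> 2 * y ^ 3" and "1 - cos y \<le> y\<^sup>2 / 2"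
proof -
  have *: "1 - cos x \<le> x\<^sup>2 / 2" for x :: real
  proof -
    have "(sin (x / 2))\<^sup>2 \<le> (x / 2)\<^sup>2" using abs_sin_x_le_abs_x[of "x/2"] by (simp only: abs_le_square_iff)
    then show ?thesis using cos_double_sin[of "x / 2"] by (simp add: power_divide)
  qed
  show "1 - cos y \<le> y\<^sup>2 / 2" by (rule *)
  show "1 - cos (y\<^sup>2) \<le> 2 * y ^ 3"
  proof (cases "y \<le> 1")
    case True
    have "1 - cos (y\<^sup>2) \<le> y ^ 4 / 2" using *[of "y\<^sup>2"] by (simp add: power_mult[symmetric])
    also have "y ^ 4 \<le> y ^ 3" using True assms by (intro power_decreasing) auto
    finally show ?thesis using zero_le_power[OF assms, of 3] by linarith
  next
    case False
    have "1 - cos (y\<^sup>2) \<le> 2" using cos_ge_minus_one[of "y\<^sup>2"] by linarith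
    moreover have "1 \<le> y ^ 3" using False by (intro one_le_power) auto
    ultimately show ?thesis by linarith
  qed
qed

lemma abs_sin_square_le:
  fixes y :: real assumes "0 \<le> y" shows "\<bar>sin (y\<^sup>2)\<bar> \<le> y"
proof (cases "y \<le> 1")
  case True
  have "\<bar>sin (y\<^sup>2)\<bar> \<le> y\<^sup>2" using abs_sin_x_le_abs_x[of "y\<^sup>2"] by simp
  also have "\<dots> \<le> y" using True assms by (simp add: power2_eq_square mult_left_le)
  finally show ?thesis .
qed (use abs_sin_le_one[of "y\<^sup>2"] in linarith)

text \<open>
  The difference is of order \<open>sqrt d * j powr (- 3 / 2)\<close>: summable in \<open>j\<close>, and small with \<open>d\<close>. Writing
  \<open>d = s\<^sup>2\<close> and \<open>j = q\<^sup>2\<close> keeps the estimate polynomial; the inputs are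
  \<open>1 - cos (y\<^sup>2) \<le> 2 * y\<^sup>3\<close> and \<open>\<bar>sin (y\<^sup>2)\<bar> \<le> y\<close>, weakened interpolations between the behaviour near 0
  and boundedness.
\<close>

lemma triangle_coeff_step:
  assumes s: "s > 0" and q: "q > 0" "q\<^sup>2 = real_of_int j"
  shows "\<bar>triangle_coeff (s\<^sup>2) j - triangle_coeff (s\<^sup>2) (j + 1)\<bar> \<le> 2 * s / q ^ 3"
proof -
  have "0 < real_of_int j" unfolding q(2)[symmetric] using q(1) by simp
  then have j: "real_of_int j \<ge> 1" "j > 0" by simp_all
  define a b where "a = 1 - cos (real_of_int j * s\<^sup>2)" and "b = 1 - cos (real_of_int (j + 1) * s\<^sup>2)"
  have a0: "0 \<le> a" by (simp add: a_def)
  have a: "a \<le> 2 * (s * q) ^ 3"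
    using one_minus_cos_le(1)[of "s * q"] s q by (simp add: a_def power_mult_distrib mult.commute)
  have ab: "\<bar>a - b\<bar> \<le> 2 * q * s ^ 3"
  proof -
    define y where "y = s * sqrt (real_of_int j + 1 / 2)"
    have "a - b = 2 * sin (y\<^sup>2) * sin (- (s\<^sup>2 / 2))"
      unfolding a_def b_def y_def using j
      by (simp add: power_mult_distrib cos_diff_cos algebra_simps add_divide_distrib diff_divide_distrib)
    also have "\<bar>\<dots>\<bar> = 2 * \<bar>sin (y\<^sup>2)\<bar> * \<bar>sin (s\<^sup>2 / 2)\<bar>" by (simp add: abs_mult)
    also have "\<dots> \<le> 2 * y * (s\<^sup>2 / 2)"
      using abs_sin_square_le[of y] abs_sin_x_le_abs_x[of "s\<^sup>2/2"] s j
      by (intro mult_mono) (auto simp: y_def)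
    also have "y \<le> s * (2 * q)"
      unfolding y_def using s q j by (intro mult_left_mono real_le_lsqrt) (auto simp: power_mult_distrib)
    finally show ?thesis using s by (simp add: power3_eq_cube power2_eq_square mult_ac)
  qed
  have j2: "real_of_int j ^ 2 = q ^ 4" by (simp flip: q(2))
  have inv: "1 / real_of_int j ^ 2 - 1 / real_of_int (j + 1) ^ 2 \<le> 2 / q ^ 6"
  proof -
    have "1 / real_of_int j ^ 2 - 1 / real_of_int (j + 1) ^ 2 =
      (2 * real_of_int j + 1) / (real_of_int j ^ 2 * (real_of_int j + 1) ^ 2)"
      using j by (simp add: divide_simps) (simp add: power2_eq_square algebra_simps)
    also have "\<dots> \<le> 2 / real_of_int j ^ 3"
      using j by (simp add: divide_simps) (simp add: power2_eq_square power3_eq_cube algebra_simps)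
    also have "real_of_int j ^ 3 = q ^ 6" by (simp flip: q(2))
    finally show ?thesis .
  qed
  have inv0: "0 \<le> 1 / real_of_int j ^ 2 - 1 / real_of_int (j + 1) ^ 2"
    using j by (simp add: divide_simps power2_eq_square mult_mono)
  have "pi * s\<^sup>2 * \<bar>triangle_coeff (s\<^sup>2) j - triangle_coeff (s\<^sup>2) (j + 1)\<bar> =
     \<bar>pi * s\<^sup>2 * (triangle_coeff (s\<^sup>2) j - triangle_coeff (s\<^sup>2) (j + 1))\<bar>"
    by (simp add: abs_mult)
  also have "pi * s\<^sup>2 * (triangle_coeff (s\<^sup>2) j - triangle_coeff (s\<^sup>2) (j + 1)) =
      a / real_of_int j ^ 2 - b / real_of_int (j + 1) ^ 2"
    unfolding triangle_coeff_def a_def b_def using j s by (simp add: divide_simps)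
  also have "\<dots> = a * (1 / real_of_int j ^ 2 - 1 / real_of_int (j + 1) ^ 2) + (a - b) / real_of_int (j + 1) ^ 2"
    by (simp add: algebra_simps diff_divide_distrib)
  also have "\<bar>\<dots>\<bar> \<le> a * (1 / real_of_int j ^ 2 - 1 / real_of_int (j + 1) ^ 2) + \<bar>a - b\<bar> / real_of_int (j + 1) ^ 2"
    by (rule order_trans[OF abs_triangle_ineq]) (use a0 inv0 in \<open>simp add: abs_mult\<close>)
  also have "\<dots> \<le> 2 * (s * q) ^ 3 * (2 / q ^ 6) + 2 * q * s ^ 3 / q ^ 4"
  proof (intro add_mono mult_mono frac_le)
    show "q ^ 4 \<le> real_of_int (j + 1) ^ 2" unfolding j2[symmetric] using j by (intro power_mono) auto
  qed (use a inv inv0 ab s q in auto)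
  also have "\<dots> = 6 * s ^ 3 / q ^ 3"
    using q(1) by (simp add: divide_simps power_mult_distrib) (simp add: algebra_simps eval_nat_numeral)
  finally have "pi * s\<^sup>2 * \<bar>triangle_coeff (s\<^sup>2) j - triangle_coeff (s\<^sup>2) (j + 1)\<bar> \<le> 6 * s ^ 3 / q ^ 3" .
  moreover have "3 * s\<^sup>2 * \<bar>triangle_coeff (s\<^sup>2) j - triangle_coeff (s\<^sup>2) (j + 1)\<bar> \<le>
      pi * s\<^sup>2 * \<bar>triangle_coeff (s\<^sup>2) j - triangle_coeff (s\<^sup>2) (j + 1)\<bar>"
    using pi_gt3 by (intro mult_right_mono) auto
  ultimately have "3 * s\<^sup>2 * \<bar>triangle_coeff (s\<^sup>2) j - triangle_coeff (s\<^sup>2) (j + 1)\<bar> \<le> 3 * s\<^sup>2 * (2 * s / q ^ 3)"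
    by (simp add: power2_eq_square power3_eq_cube)
  then show ?thesis using s by (subst (asm) mult_le_cancel_left_pos) auto
qed

section \<open>Cutoff functions of small variation\<close>

lemma triangle_coeff_le: "0 < d \<Longrightarrow> triangle_coeff d k \<le> d / (2 * pi)"
proof (cases "k = 0")
  case False
  assume d: "0 < d"
  have "1 - cos (of_int k * d) = 1 - cos \<bar>of_int k * d\<bar>" by (simp add: abs_if)
  also have "\<dots> \<le> (of_int k * d)\<^sup>2 / 2"
    using one_minus_cos_le(2)[of "\<bar>of_int k * d\<bar>"] by simp
  finally show ?thesis
    using False d by (simp add: triangle_coeff_def divide_simps) (simp add: power2_eq_square mult_ac)
qed (simp add: triangle_coeff_def)

text \<open>
  The norm of \<open>(exp (i n t) - 1) * \<phi> t\<close> in the scalar Wiener algebra if \<open>p\<close> are the Fourier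
  coefficients of \<open>\<phi>\<close>.
\<close>

definition variation :: "(int \<Rightarrow> real) \<Rightarrow> int \<Rightarrow> real" where
  "variation p n = (\<Sum>\<^sub>\<infinity>k. \<bar>p (k - n) - p k\<bar>)"

lemma summable_on_shift:
  fixes p :: "int \<Rightarrow> real"
  assumes "(\<lambda>k. \<bar>p k\<bar>) summable_on UNIV"
  shows "(\<lambda>k. \<bar>p (k - n)\<bar>) summable_on UNIV" "(\<Sum>\<^sub>\<infinity>k. \<bar>p (k - n)\<bar>) = (\<Sum>\<^sub>\<infinity>k. \<bar>p k\<bar>)"
proof -
  have bij: "bij_betw (\<lambda>k::int. k - n) UNIV UNIV"
    by (rule bij_betwI[where g = "\<lambda>k. k + n"]) auto
  show "(\<lambda>k. \<bar>p (k - n)\<bar>) summable_on UNIV"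
    using summable_on_reindex_bij_betw[OF bij, of "\<lambda>k. \<bar>p k\<bar>"] assms by simp
  show "(\<Sum>\<^sub>\<infinity>k. \<bar>p (k - n)\<bar>) = (\<Sum>\<^sub>\<infinity>k. \<bar>p k\<bar>)"
    by (rule infsum_reindex_bij_betw[OF bij, of "\<lambda>k. \<bar>p k\<bar>"])
qed

lemma summable_variation:
  fixes p :: "int \<Rightarrow> real"
  assumes "(\<lambda>k. \<bar>p k\<bar>) summable_on UNIV"
  shows "(\<lambda>k. \<bar>p (k - n) - p k\<bar>) summable_on UNIV"
  by (rule summable_on_comparison_test[OF summable_on_add[OF summable_on_shift(1)[OF assms, of n] assms]]) auto

lemma variation_nonneg: "0 \<le> variation p n"
  unfolding variation_def by (intro infsum_nonneg) auto

lemma variation_le_2: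
  assumes "(\<lambda>k. \<bar>p k\<bar>) summable_on UNIV"
  shows "variation p n \<le> 2 * (\<Sum>\<^sub>\<infinity>k. \<bar>p k\<bar>)"
proof -
  have "variation p n \<le> (\<Sum>\<^sub>\<infinity>k. \<bar>p (k - n)\<bar> + \<bar>p k\<bar>)"
    unfolding variation_def
    by (intro infsum_mono summable_variation[OF assms] summable_on_add summable_on_shift(1)[OF assms] assms) auto
  also have "\<dots> = (\<Sum>\<^sub>\<infinity>k. \<bar>p (k - n)\<bar>) + (\<Sum>\<^sub>\<infinity>k. \<bar>p k\<bar>)"
    by (intro infsum_add summable_on_shift(1)[OF assms] assms)
  finally show ?thesis using summable_on_shift(2)[OF assms, of n] by simp
qed

text \<open>
  \<open>e\<^sub>m\<^sub>+\<^sub>n - 1 = e\<^sub>m (e\<^sub>n - 1) + (e\<^sub>m - 1)\<close>, and multiplication by \<open>e\<^sub>m\<close> preserves the norm.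
\<close>

lemma variation_add_le:
  assumes "(\<lambda>k. \<bar>p k\<bar>) summable_on UNIV"
  shows "variation p (m + n) \<le> variation p m + variation p n"
proof -
  let ?q = "\<lambda>k. p (k - n) - p k"
  have q: "(\<lambda>k. \<bar>?q k\<bar>) summable_on UNIV" using summable_variation[OF assms] .
  have "variation p (m + n) \<le> (\<Sum>\<^sub>\<infinity>k. \<bar>?q (k - m)\<bar> + \<bar>p (k - m) - p k\<bar>)"
    unfolding variation_def
    by (intro infsum_mono summable_variation[OF assms] summable_on_add summable_on_shift(1)[OF q])
       (auto simp: algebra_simps)
  also have "\<dots> = (\<Sum>\<^sub>\<infinity>k. \<bar>?q (k - m)\<bar>) + (\<Sum>\<^sub>\<infinity>k. \<bar>p (k - m) - p k\<bar>)"
    by (intro infsum_add summable_on_shift(1)[OF q] summable_variation[OF assms])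
  also have "\<dots> = variation p n + variation p m"
    unfolding summable_on_shift(2)[OF q] variation_def ..
  finally show ?thesis by simp
qed

lemma variation_minus:
  assumes "(\<lambda>k. \<bar>p k\<bar>) summable_on UNIV"
  shows "variation p (- n) = variation p n"
proof -
  have bij: "bij_betw (\<lambda>k::int. k + n) UNIV UNIV"
    by (rule bij_betwI[where g = "\<lambda>k. k - n"]) auto
  have "variation p (- n) = (\<Sum>\<^sub>\<infinity>k. \<bar>p (k + n - n) - p (k + n)\<bar>)"
    by (simp add: variation_def abs_minus_commute)
  also have "\<dots> = variation p n"
    unfolding variation_def by (rule infsum_reindex_bij_betw[OF bij, of "\<lambda>k. \<bar>p (k - n) - p k\<bar>"])
  finally show ?thesis .
qed

lemma variation_le_mult:
  assumes "(\<lambda>k. \<bar>p k\<bar>) summable_on UNIV"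
  shows "variation p n \<le> real_of_int \<bar>n\<bar> * variation p 1"
proof -
  have nat: "variation p (int m) \<le> real m * variation p 1" for m
  proof (induction m)
    case 0 then show ?case by (simp add: variation_def)
  next
    case (Suc m)
    have "variation p (int (Suc m)) \<le> variation p (int m) + variation p 1"
      using variation_add_le[OF assms, of "int m" 1] by (simp add: add.commute)
    then show ?case using Suc by (simp add: algebra_simps)
  qed
  have "variation p n = variation p \<bar>n\<bar>" using variation_minus[OF assms, of n] by (simp add: abs_if)
  then show ?thesis using nat[of "nat \<bar>n\<bar>"] by simp
qed

lemma summable_triangle_coeff:
  assumes "0 < d" "d \<le> pi"
  shows "(\<lambda>k. \<bar>triangle_coeff d k\<bar>) summable_on UNIV" "(\<Sum>\<^sub>\<infinity>k. \<bar>triangle_coeff d k\<bar>) = 1"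
  using triangle_coeff_has_sum_1[OF assms] triangle_coeff_nonneg[OF assms(1)]
  by (auto simp: has_sum_iff)

text \<open>
  Narrow triangle functions live where \<open>exp (i t)\<close> is almost 1.
\<close>

lemma triangle_variation:
  "\<exists>K. \<forall>s. 0 < s \<longrightarrow> s \<le> 1 \<longrightarrow> variation (triangle_coeff (s\<^sup>2)) 1 \<le> K * s"
proof -
  \<comment> \<open>A summable majorant; \<open>k = 0\<close> and \<open>k = 1\<close> involve the coefficient with index 0, where the step estimate is void.\<close>
  define \<rho> where "\<rho> = (\<lambda>k. if k = 0 \<or> k = 1 then 1 else 1 / sqrt (real_of_int (if k > 1 then k - 1 else - k)) ^ 3)"
  have pw: "1 / sqrt (real n) ^ 3 = real n powr (- 3 / 2)" if "n > 0" for n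
  proof -
    have "sqrt (real n) ^ 3 = (real n powr (1 / 2)) ^ 3" using that by (simp only: powr_half_sqrt of_nat_0_le_iff)
    also have "\<dots> = real n powr (3 / 2)" using that by (simp add: powr_power)
    finally show ?thesis by (simp add: powr_minus_divide)
  qed
  have "summable (\<lambda>n. real n powr (- 3 / 2))" by (subst summable_real_powr_iff) simp
  then have "(\<lambda>n. real n powr (- 3 / 2)) summable_on UNIV" by (subst summable_on_UNIV_nonneg_real_iff) auto
  then have powr: "(\<lambda>n. real n powr (- 3 / 2)) summable_on A" for A
    using summable_on_subset by blast
  have "\<rho> (int (Suc n)) = (if n = 0 then 1 else real n powr (- 3 / 2))" for n
    using pw[of n] by (auto simp: \<rho>_def)
  moreover have "(\<lambda>n::nat. if n = 0 then 1 else real n powr (- 3 / 2)) summable_on UNIV"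
  proof -
    have "(\<lambda>n::nat. (if n = 0 then 1 else real n powr (- 3 / 2))) summable_on insert 0 (UNIV - {0})"
      using powr[of "UNIV - {0}"] unfolding summable_on_insert_iff
      by (subst summable_on_cong[of _ _ "\<lambda>n. real n powr (- 3 / 2)"]) auto
    then show ?thesis by (simp add: insert_UNIV)
  qed
  ultimately have pos: "(\<lambda>n. \<rho> (int (Suc n))) summable_on UNIV" by simp
  have "\<rho> (- int (Suc n)) = real (Suc n) powr (- 3 / 2)" for n
    unfolding pw[OF zero_less_Suc, symmetric] by (simp add: \<rho>_def add.commute)
  moreover have "(\<lambda>n. real (Suc n) powr (- 3 / 2)) summable_on UNIV"
    using powr[of "range Suc"] by (subst (asm) summable_on_reindex) (auto simp: o_def)
  ultimately have neg: "(\<lambda>n. \<rho> (- int (Suc n))) summable_on UNIV" by simp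
  have summ: "\<rho> summable_on UNIV"
    using has_sum_int[OF has_sum_infsum[OF pos] has_sum_infsum[OF neg]] by (rule has_sum_imp_summable)
  have bound: "\<bar>triangle_coeff (s\<^sup>2) (k - 1) - triangle_coeff (s\<^sup>2) k\<bar> \<le> 2 * s * \<rho> k" if s: "0 < s" "s \<le> 1" for s k
  proof -
    have neg: "\<bar>triangle_coeff (s\<^sup>2) j - triangle_coeff (s\<^sup>2) (j + 1)\<bar> \<le> 2 * s * (1 / sqrt (real_of_int j) ^ 3)"
      if "j > 0" for j
      using triangle_coeff_step[OF s(1), of "sqrt (real_of_int j)" j] that by simp
    consider "k > 1" | "k = 0 \<or> k = 1" | "k < 0" by arith
    then show ?thesis
    proof cases
      case 1
      then show ?thesis using neg[of "k - 1"] by (simp add: \<rho>_def)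
    next
      case 3
      have eq: "triangle_coeff (s\<^sup>2) (- k) = triangle_coeff (s\<^sup>2) k"
        "triangle_coeff (s\<^sup>2) (- k + 1) = triangle_coeff (s\<^sup>2) (k - 1)"
        using triangle_coeff_minus[of "s\<^sup>2" k] triangle_coeff_minus[of "s\<^sup>2" "k - 1"] by simp_all
      show ?thesis using 3 neg[of "- k"] unfolding eq by (simp add: \<rho>_def abs_minus_commute)
    next
      case 2
      have "0 \<le> triangle_coeff (s\<^sup>2) j \<and> triangle_coeff (s\<^sup>2) j \<le> s" for j
      proof -
        have "triangle_coeff (s\<^sup>2) j \<le> s\<^sup>2 / (2 * pi)" using triangle_coeff_le[of "s\<^sup>2" j] s by simp
        also have "\<dots> \<le> s\<^sup>2 / 1" using pi_gt3 by (intro divide_left_mono) auto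
        also have "\<dots> \<le> s" using s by (simp add: power2_eq_square mult_left_le)
        finally show ?thesis using triangle_coeff_nonneg[of "s\<^sup>2" j] s by simp
      qed
      from this[of k] this[of "k - 1"] have "\<bar>triangle_coeff (s\<^sup>2) (k - 1) - triangle_coeff (s\<^sup>2) k\<bar> \<le> s" by linarith
      moreover have "\<rho> k = 1" using 2 by (auto simp: \<rho>_def)
      ultimately show ?thesis using s(1) by simp
    qed
  qed
  show ?thesis
  proof (intro exI[of _ "2 * infsum \<rho> UNIV"] allI impI)
    fix s :: real assume s: "0 < s" "s \<le> 1"
    have "s\<^sup>2 \<le> 1" using s by (simp add: power_le_one)
    then have "s\<^sup>2 \<le> pi" using pi_gt3 by linarith
    then have "variation (triangle_coeff (s\<^sup>2)) 1 \<le> (\<Sum>\<^sub>\<infinity>k. 2 * s * \<rho> k)"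
      unfolding variation_def using s(1)
      by (intro infsum_mono[OF summable_variation[OF summable_triangle_coeff(1)]]
            summable_on_cmult_right summ bound s) auto
    also have "(\<Sum>\<^sub>\<infinity>k. 2 * s * \<rho> k) = 2 * s * infsum \<rho> UNIV" by (rule infsum_cmult_right')
    finally show "variation (triangle_coeff (s\<^sup>2)) 1 \<le> 2 * infsum \<rho> UNIV * s" by (simp add: mult_ac)
  qed
qed

lemma infsum_linear_combination:
  fixes f g :: "'k \<Rightarrow> real"
  assumes "f summable_on I" "g summable_on I"
  shows "(\<Sum>\<^sub>\<infinity>k\<in>I. a * f k + b * g k) = a * infsum f I + b * infsum g I"
  using infsum_add[OF summable_on_cmult_right[OF assms(1), of a] summable_on_cmult_right[OF assms(2), of b]]
  by (simp only: infsum_cmult_right')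

text \<open>
  The trapezoid \<open>4/3 * \<Delta>\<^bsub>4d\<^esub> - 1/3 * \<Delta>\<^bsub>d\<^esub>\<close>, where \<open>\<Delta>\<^bsub>d\<^esub>\<close> is the triangle of half-width \<open>d\<close>, is
  1 on \<open>[-d, d]\<close> because the slopes of the two triangles cancel there. Its norm is at most
  \<open>4/3 + 1/3\<close> whatever \<open>d\<close> is, while its variation tends to 0 with \<open>d\<close>. The wide triangle has
  half-width \<open>4d\<close> so that both widths are squares, as \<open>triangle_variation\<close> wants them.
\<close>

lemma cutoff_exists:
  assumes "\<epsilon> > 0"
  shows "\<exists>p \<eta>. \<eta> > 0 \<and> (\<lambda>k. \<bar>p k\<bar>) summable_on UNIV \<and> (\<Sum>\<^sub>\<infinity>k. \<bar>p k\<bar>) \<le> 3 \<and>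
    variation p 1 \<le> \<epsilon> \<and> (\<forall>t. \<bar>t\<bar> \<le> \<eta> \<longrightarrow> (\<Sum>\<^sub>\<infinity>k. of_real (p k) * harmonic k t) = 1)"
proof -
  obtain K where K: "\<And>s. 0 < s \<Longrightarrow> s \<le> 1 \<Longrightarrow> variation (triangle_coeff (s\<^sup>2)) 1 \<le> K * s"
    using triangle_variation by auto
  have "0 \<le> K" using order_trans[OF variation_nonneg K[of 1]] by simp
  \<comment> \<open>The variation is at most \<open>4/3 * (2 K s) + 1/3 * (K s) \<le> 5 K s\<close>; \<open>K + 1\<close> avoids dividing by zero.\<close>
  define s where "s = min (1 / 2) (\<epsilon> / (5 * (K + 1)))"
  have s: "0 < s" "s \<le> 1 / 2" "5 * K * s \<le> \<epsilon>"
  proof -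
    show "0 < s" using assms \<open>0 \<le> K\<close> by (simp add: s_def)
    show "s \<le> 1 / 2" unfolding s_def by (rule min.cobounded1)
    have "5 * K * s \<le> 5 * (K + 1) * (\<epsilon> / (5 * (K + 1)))"
      using \<open>0 \<le> K\<close> \<open>0 < s\<close> by (intro mult_mono) (auto simp: s_def)
    then show "5 * K * s \<le> \<epsilon>" using \<open>0 \<le> K\<close> by simp
  qed
  define d where "d = s\<^sup>2"
  have d4: "(2 * s)\<^sup>2 = 4 * d" by (simp add: d_def power_mult_distrib)
  have "d \<le> 1 / 4" unfolding d_def using power_mono[of s "1 / 2" 2] s by (simp add: power_divide)
  moreover have "0 < d" unfolding d_def using s(1) by simp
  ultimately have d: "0 < d" "d \<le> pi" "0 < 4 * d" "4 * d \<le> pi"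
    using pi_gt3 by linarith+
  define p where "p = (\<lambda>k. 4 / 3 * triangle_coeff (4 * d) k - 1 / 3 * triangle_coeff d k)"
  note S1 = summable_triangle_coeff[OF d(1,2)] and S4 = summable_triangle_coeff[OF d(3,4)]
  have pb: "\<bar>p k\<bar> \<le> 4 / 3 * \<bar>triangle_coeff (4 * d) k\<bar> + 1 / 3 * \<bar>triangle_coeff d k\<bar>" for k
    unfolding p_def by linarith
  have summ_b: "(\<lambda>k. 4 / 3 * \<bar>triangle_coeff (4 * d) k\<bar> + 1 / 3 * \<bar>triangle_coeff d k\<bar>) summable_on UNIV"
    by (intro summable_on_add summable_on_cmult_right S1(1) S4(1))
  have summ: "(\<lambda>k. \<bar>p k\<bar>) summable_on UNIV"
    by (rule summable_on_comparison_test[OF summ_b]) (use pb in auto)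
  have "(\<Sum>\<^sub>\<infinity>k. \<bar>p k\<bar>) \<le> (\<Sum>\<^sub>\<infinity>k. 4 / 3 * \<bar>triangle_coeff (4 * d) k\<bar> + 1 / 3 * \<bar>triangle_coeff d k\<bar>)"
    by (intro infsum_mono summ summ_b pb)
  also have "\<dots> = 4 / 3 * 1 + 1 / 3 * 1"
    unfolding infsum_linear_combination[OF S4(1) S1(1)] S1(2) S4(2) ..
  finally have le3: "(\<Sum>\<^sub>\<infinity>k. \<bar>p k\<bar>) \<le> 3" by simp
  have "variation p 1 \<le> (\<Sum>\<^sub>\<infinity>k. 4 / 3 * \<bar>triangle_coeff (4 * d) (k - 1) - triangle_coeff (4 * d) k\<bar> +
      1 / 3 * \<bar>triangle_coeff d (k - 1) - triangle_coeff d k\<bar>)"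
    unfolding variation_def
  proof (rule infsum_mono[OF summable_variation[OF summ, where n = 1]])
    show "(\<lambda>k. 4 / 3 * \<bar>triangle_coeff (4 * d) (k - 1) - triangle_coeff (4 * d) k\<bar> +
      1 / 3 * \<bar>triangle_coeff d (k - 1) - triangle_coeff d k\<bar>) summable_on UNIV"
      by (rule summable_on_add[OF
            summable_on_cmult_right[OF summable_variation[OF S4(1), where n = 1]]
            summable_on_cmult_right[OF summable_variation[OF S1(1), where n = 1]]])
    fix k
    show "\<bar>p (k - 1) - p k\<bar> \<le> 4 / 3 * \<bar>triangle_coeff (4 * d) (k - 1) - triangle_coeff (4 * d) k\<bar> +
      1 / 3 * \<bar>triangle_coeff d (k - 1) - triangle_coeff d k\<bar>"
    proof -
      have *: "\<bar>4 / 3 * x - 1 / 3 * y\<bar> \<le> 4 / 3 * \<bar>x\<bar> + 1 / 3 * \<bar>y\<bar>" for x y :: real by linarith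
      have eq: "p (k - 1) - p k = 4 / 3 * (triangle_coeff (4 * d) (k - 1) - triangle_coeff (4 * d) k) -
          1 / 3 * (triangle_coeff d (k - 1) - triangle_coeff d k)"
        by (simp add: p_def algebra_simps)
      show ?thesis unfolding eq by (rule *)
    qed
  qed
  also have "\<dots> = 4 / 3 * variation (triangle_coeff (4 * d)) 1 + 1 / 3 * variation (triangle_coeff d) 1"
    unfolding variation_def
    by (rule infsum_linear_combination[OF summable_variation[OF S4(1), where n = 1] summable_variation[OF S1(1), where n = 1]])
  also have "\<dots> \<le> 4 / 3 * (K * (2 * s)) + 1 / 3 * (K * s)"
    using K[of "2 * s"] K[of s] s unfolding d4 by (intro add_mono mult_left_mono) (auto simp: d_def)
  also have "\<dots> \<le> 5 * K * s" using \<open>0 \<le> K\<close> s(1) by simp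
  finally have var: "variation p 1 \<le> \<epsilon>" using s(3) by linarith
  show ?thesis
  proof (intro exI[of _ p] exI[of _ d] conjI d(1) summ le3 var allI impI)
    fix t :: real assume t: "\<bar>t\<bar> \<le> d"
    have tpi: "\<bar>t\<bar> \<le> pi" using t d by linarith
    have "((\<lambda>k. of_real (4 / 3) * (of_real (triangle_coeff (4 * d) k) * harmonic k t) +
        of_real (- 1 / 3) * (of_real (triangle_coeff d k) * harmonic k t)) has_sum
        of_real (4 / 3) * of_real (max 0 (1 - \<bar>t\<bar> / (4 * d))) + of_real (- 1 / 3) * of_real (max 0 (1 - \<bar>t\<bar> / d))) UNIV"
      by (intro has_sum_add has_sum_cmult_right triangle_has_sum d tpi)
    also have "(\<lambda>k. of_real (4 / 3) * (of_real (triangle_coeff (4 * d) k) * harmonic k t) +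
        of_real (- 1 / 3) * (of_real (triangle_coeff d k) * harmonic k t)) = (\<lambda>k. of_real (p k) * harmonic k t)"
      by (simp add: p_def algebra_simps)
    also have "of_real (4 / 3) * of_real (max 0 (1 - \<bar>t\<bar> / (4 * d))) + of_real (- 1 / 3) * of_real (max 0 (1 - \<bar>t\<bar> / d)) = (1 :: complex)"
    proof -
      have *: "4 / 3 * max 0 (1 - \<bar>t\<bar> / (4 * d)) + (- 1 / 3) * max 0 (1 - \<bar>t\<bar> / d) = 1"
        using t d by (simp add: max_def divide_simps)
      show ?thesis unfolding of_real_mult[symmetric] of_real_add[symmetric] * by (rule of_real_1)
    qed
    finally show "(\<Sum>\<^sub>\<infinity>k. of_real (p k) * harmonic k t) = 1" by (rule infsumI)
  qed
qed

section \<open>Wiener series in a Banach subspace\<close>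

lemma complex_normed_subspace_complex: "complex_normed_subspace (*) (UNIV :: complex set) cmod"
  by unfold_locales
     (auto simp: algebra_simps norm_mult norm_triangle_ineq module.subspace_def module_def)

lemma abs_sums_complex_iff:
  fixes c :: "'k \<Rightarrow> complex"
  shows "complex_normed_subspace.abs_sums UNIV cmod c I x \<longleftrightarrow>
     (\<lambda>i. cmod (c i)) summable_on I \<and> (c has_sum x) I"
  unfolding complex_normed_subspace.abs_sums_def[OF complex_normed_subspace_complex] has_sum_def
  by (auto simp: tendsto_norm_zero_iff LIM_zero_iff)

context complex_normed_subspace
begin

lemma norm_scale_harmonic: "x \<in> S \<Longrightarrow> N (scaleC (harmonic n t) x) = N x"
  by (simp add: norm_scale norm_harmonic)

lemma scale_harmonic_family:
  assumes "c ` I \<subseteq> S" "(\<lambda>i. N (c i)) summable_on I"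
  shows "(\<lambda>i. scaleC (harmonic (\<nu> i) t) (c i)) ` I \<subseteq> S"
    and "(\<lambda>i. N (scaleC (harmonic (\<nu> i) t) (c i))) summable_on I"
    and "(\<Sum>\<^sub>\<infinity>i\<in>I. N (scaleC (harmonic (\<nu> i) t) (c i))) = (\<Sum>\<^sub>\<infinity>i\<in>I. N (c i))"
proof -
  have cS: "c i \<in> S" if "i \<in> I" for i using assms(1) that by blast
  have eq: "N (scaleC (harmonic (\<nu> i) t) (c i)) = N (c i)" if "i \<in> I" for i
    by (rule norm_scale_harmonic[OF cS[OF that]])
  show "(\<lambda>i. scaleC (harmonic (\<nu> i) t) (c i)) ` I \<subseteq> S"
    by (intro image_subsetI subspace_scale[OF subspace_carrier] cS)
  have "(\<lambda>i. N (scaleC (harmonic (\<nu> i) t) (c i))) summable_on I \<longleftrightarrow> (\<lambda>i. N (c i)) summable_on I"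
    by (rule summable_on_cong) (rule eq)
  then show "(\<lambda>i. N (scaleC (harmonic (\<nu> i) t) (c i))) summable_on I" using assms(2) by simp
  show "(\<Sum>\<^sub>\<infinity>i\<in>I. N (scaleC (harmonic (\<nu> i) t) (c i))) = (\<Sum>\<^sub>\<infinity>i\<in>I. N (c i))"
    by (rule infsum_cong) (rule eq)
qed

lemma wiener_series_iff:
  "wiener_series scaleC S N c f \<longleftrightarrow> range c \<subseteq> S \<and> (\<lambda>n. N (c n)) summable_on UNIV \<and>
     (\<forall>t. abs_sums (\<lambda>n. scaleC (harmonic n t) (c n)) UNIV (f t))"
  unfolding wiener_series_def
  using limitin_norm_topology_iff[OF scale_harmonic_family(1,2)[where I = UNIV and c = c and \<nu> = "\<lambda>n. n"]]
  by (intro conj_cong all_cong refl) auto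

lemma abs_sums_scale_left:
  assumes v: "v \<in> S" and q: "(\<lambda>k. cmod (q k)) summable_on I" "(q has_sum z) I"
  shows "abs_sums (\<lambda>k. scaleC (q k) v) I (scaleC z v)"
  by (rule abs_sums_image[OF complex_normed_subspace_complex complex_normed_subspace_axioms,
        where T = "\<lambda>z. scaleC z v" and K = "N v"])
     (use v q in \<open>auto simp: abs_sums_complex_iff Modules.additive_def scale_left_distrib norm_scale
        intro: subspace_scale[OF subspace_carrier]\<close>)

lemma wiener_series_periodic:
  assumes "wiener_series scaleC S N c f"
  shows "f (t + 2 * pi * of_int k) = f t"
proof -
  have "abs_sums (\<lambda>n. scaleC (harmonic n (t + 2 * pi * of_int k)) (c n)) UNIV (f (t + 2 * pi * of_int k))"
    "abs_sums (\<lambda>n. scaleC (harmonic n t) (c n)) UNIV (f t)"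
    using assms unfolding wiener_series_iff by blast+
  then show ?thesis unfolding harmonic_periodic by (rule abs_sums_unique)
qed

end

context complex_banach_subspace
begin

text \<open>
  Terms of equal frequency are added up. By the triangle inequality the norm does not grow.
\<close>

lemma wiener_series_of_family:
  assumes c: "c ` I \<subseteq> S" "(\<lambda>i. N (c i)) summable_on I"
    and f: "\<And>t. abs_sums (\<lambda>i. scaleC (harmonic (\<nu> i) t) (c i)) I (f t)"
  shows "\<exists>c'. wiener_series scaleC S N c' f \<and> (\<Sum>\<^sub>\<infinity>n. N (c' n)) \<le> (\<Sum>\<^sub>\<infinity>i\<in>I. N (c i))"
proof -
  have "\<exists>x. abs_sums c {i \<in> I. \<nu> i = n} x" for n
    using c by (intro abs_sums_exists) (auto intro: summable_on_subset)
  then obtain c' where c': "\<And>n. abs_sums c {i \<in> I. \<nu> i = n} (c' n)" by metis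
  then have c'S: "c' n \<in> S" for n by (auto simp: abs_sums_def)
  have fib: "abs_sums (\<lambda>i. scaleC (harmonic (\<nu> i) t) (c i)) {i \<in> I. \<nu> i = n} (scaleC (harmonic n t) (c' n))" for n t
    using abs_sums_scale[OF c'[of n], of "harmonic n t"]
    by (subst abs_sums_cong[where d = "\<lambda>i. scaleC (harmonic n t) (c i)"]) auto
  \<comment> \<open>The instance \<open>t = 0\<close> gives the norm estimate, since all harmonics have modulus 1.\<close>
  note regroup = abs_sums_regroup[where J = UNIV and p = \<nu>, OF f _ fib]
  have sums: "abs_sums (\<lambda>n. scaleC (harmonic n t) (c' n)) UNIV (f t)" for t
    using regroup(1) by simp
  have "(\<Sum>\<^sub>\<infinity>n. N (scaleC (harmonic n 0) (c' n))) \<le> (\<Sum>\<^sub>\<infinity>i\<in>I. N (scaleC (harmonic (\<nu> i) 0) (c i)))"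
    by (rule regroup(2)) simp
  then have le: "(\<Sum>\<^sub>\<infinity>n. N (c' n)) \<le> (\<Sum>\<^sub>\<infinity>i\<in>I. N (c i))"
    unfolding scale_harmonic_family(3)[OF c] norm_scale_harmonic[OF c'S] .
  have "(\<lambda>n. N (scaleC (harmonic n 0) (c' n))) summable_on UNIV"
    using sums[of 0] unfolding abs_sums_def by blast
  then have "(\<lambda>n. N (c' n)) summable_on UNIV"
    unfolding norm_scale_harmonic[OF c'S] .
  then have "wiener_series scaleC S N c' f"
    unfolding wiener_series_iff using sums c'S by (intro conjI image_subsetI allI)
  with le show ?thesis by (intro exI conjI)
qed

text \<open>
  Since \<open>f t0 = 0\<close>, the product with the cutoff function \<open>\<phi>\<close> centred at \<open>t0\<close> is
  \<open>\<Sum>\<^sub>n \<phi> * (e\<^sub>n - e\<^sub>n(t0)) c\<^sub>n\<close>, and the scalar factor has Wiener norm \<open>variation p n\<close>.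
\<close>

lemma wiener_series_cutoff:
  assumes c: "wiener_series scaleC S N c f" and f0: "f t0 = 0"
    and p: "(\<lambda>k. \<bar>p k\<bar>) summable_on UNIV"
  shows "(\<lambda>n. variation p n * N (c n)) summable_on UNIV"
    and "\<exists>c'. wiener_series scaleC S N c'
           (\<lambda>t. scaleC (\<Sum>\<^sub>\<infinity>k. of_real (p k) * harmonic k (t - t0)) (f t)) \<and>
         (\<Sum>\<^sub>\<infinity>n. N (c' n)) \<le> (\<Sum>\<^sub>\<infinity>n. variation p n * N (c n))"
proof -
  let ?\<phi> = "\<lambda>t. \<Sum>\<^sub>\<infinity>k. of_real (p k) * harmonic k t"
  have cS: "c n \<in> S" and summ: "(\<lambda>n. N (c n)) summable_on UNIV"
    and f: "abs_sums (\<lambda>n. scaleC (harmonic n t) (c n)) UNIV (f t)" for n t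
    using c unfolding wiener_series_iff by auto
  show summ_v: "(\<lambda>n. variation p n * N (c n)) summable_on UNIV"
    by (rule summable_on_comparison_test[OF summable_on_cmult_right[OF summ, of "2 * (\<Sum>\<^sub>\<infinity>k. \<bar>p k\<bar>)"]])
       (use variation_le_2[OF p] variation_nonneg[of p] norm_nonneg[OF cS] in \<open>auto intro!: mult_right_mono\<close>)
  \<comment> \<open>The terms of \<open>\<phi> * f\<close> with frequency \<open>k\<close>, one for each \<open>n\<close>; \<open>harmonic k (- t0)\<close> moves the centre of \<open>\<phi>\<close> to \<open>t0\<close>.\<close>
  define d where "d = (\<lambda>(n, k). scaleC (of_real (p (k - n) - p k) * harmonic k (- t0) * harmonic n t0) (c n))"
  have Nd: "N (d (n, k)) = \<bar>p (k - n) - p k\<bar> * N (c n)" for n k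
    using cS by (simp add: d_def norm_scale norm_mult norm_harmonic del: of_real_diff of_real_minus)
  have dS: "range d \<subseteq> S"
    using cS by (auto simp: d_def intro: subspace_scale[OF subspace_carrier])
  have "((\<lambda>z. N (d z)) has_sum (\<Sum>\<^sub>\<infinity>n. variation p n * N (c n))) (Sigma UNIV (\<lambda>_. UNIV))"
  proof (rule has_sum_SigmaI)
    show "((\<lambda>k. N (d (n, k))) has_sum variation p n * N (c n)) UNIV" for n
      unfolding Nd variation_def by (intro has_sum_cmult_left has_sum_infsum summable_variation p)
    show "((\<lambda>n. variation p n * N (c n)) has_sum (\<Sum>\<^sub>\<infinity>n. variation p n * N (c n))) UNIV"
      by (rule has_sum_infsum[OF summ_v])
    show "(\<lambda>z. N (d z)) summable_on (Sigma UNIV (\<lambda>_. UNIV))"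
    proof (rule summable_on_SigmaI[where g = "\<lambda>n. variation p n * N (c n)"])
      show "((\<lambda>k. N (d (n, k))) has_sum variation p n * N (c n)) UNIV" for n
        unfolding Nd variation_def by (intro has_sum_cmult_left has_sum_infsum summable_variation p)
    qed (use summ_v dS norm_nonneg in auto)
  qed
  then have Nd_sum: "((\<lambda>z. N (d z)) has_sum (\<Sum>\<^sub>\<infinity>n. variation p n * N (c n))) UNIV" by simp
  have "abs_sums (\<lambda>z. scaleC (harmonic (snd z) t) (d z)) UNIV (scaleC (?\<phi> (t - t0)) (f t))" for t
  proof -
    let ?e = "\<lambda>z. scaleC (harmonic (snd z) t) (d z)"
    obtain x where x: "abs_sums ?e UNIV x"
      using abs_sums_exists[OF scale_harmonic_family(1,2)[OF dS has_sum_imp_summable[OF Nd_sum], of snd t]]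
      by blast
    let ?y = "\<lambda>n. scaleC (?\<phi> (t - t0)) (scaleC (harmonic n t) (c n)) +
       scaleC (- ?\<phi> (t - t0)) (scaleC (harmonic n t0) (c n))"
    have "abs_sums ?e {z \<in> UNIV. fst z = n} (?y n)" for n
    proof -
      have fib: "{z :: int \<times> int. z \<in> UNIV \<and> fst z = n} = Pair n ` UNIV" by auto
      let ?q = "\<lambda>k. of_real (p (k - n) - p k) * harmonic k (t - t0)"
      have e: "?e (n, k) = scaleC (?q k) (scaleC (harmonic n t0) (c n))" for k
        unfolding d_def using harmonic_add_arg[of k t "- t0"] by (simp add: mult_ac del: of_real_diff)
      have q1: "((\<lambda>k. of_real (p k) * harmonic k (t - t0)) has_sum ?\<phi> (t - t0)) UNIV"
        by (rule fourier_has_sum[OF p])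
      have bij: "bij_betw (\<lambda>k::int. k - n) UNIV UNIV"
        by (rule bij_betwI[where g = "\<lambda>k. k + n"]) auto
      have "((\<lambda>k. of_real (p (k - n)) * harmonic (k - n) (t - t0)) has_sum ?\<phi> (t - t0)) UNIV"
        using has_sum_reindex_bij_betw[OF bij, of "\<lambda>k. of_real (p k) * harmonic k (t - t0)"] q1 by simp
      then have "((\<lambda>k. harmonic n (t - t0) * (of_real (p (k - n)) * harmonic (k - n) (t - t0))) has_sum
          harmonic n (t - t0) * ?\<phi> (t - t0)) UNIV" by (rule has_sum_cmult_right)
      moreover have "harmonic n (t - t0) * (of_real (p (k - n)) * harmonic (k - n) (t - t0)) =
          of_real (p (k - n)) * harmonic k (t - t0)" for k
        using harmonic_add[of n "k - n" "t - t0"] by (simp add: mult_ac)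
      ultimately have q2: "((\<lambda>k. of_real (p (k - n)) * harmonic k (t - t0)) has_sum
          harmonic n (t - t0) * ?\<phi> (t - t0)) UNIV" by (simp only:)
      have q: "(?q has_sum (harmonic n (t - t0) * ?\<phi> (t - t0) + (-1) * ?\<phi> (t - t0))) UNIV"
        using has_sum_add[OF q2 has_sum_cmult_right[OF q1, of "-1"]] by (simp add: algebra_simps)
      have "abs_sums (\<lambda>k. scaleC (?q k) (scaleC (harmonic n t0) (c n))) UNIV
          (scaleC (harmonic n (t - t0) * ?\<phi> (t - t0) + (-1) * ?\<phi> (t - t0)) (scaleC (harmonic n t0) (c n)))"
        by (rule abs_sums_scale_left[OF subspace_scale[OF subspace_carrier cS] _ q])
           (unfold norm_mult norm_harmonic norm_of_real, simp add: summable_variation[OF p])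
      also have "scaleC (harmonic n (t - t0) * ?\<phi> (t - t0) + (-1) * ?\<phi> (t - t0)) (scaleC (harmonic n t0) (c n)) = ?y n"
      proof -
        have gen: "scaleC (H * z + (-1) * z) (scaleC h v) = scaleC z (scaleC (H * h) v) + scaleC (- z) (scaleC h v)"
          for H z h v
          unfolding scale_scale scale_left_distrib[symmetric] by (simp add: algebra_simps)
        have "harmonic n (t - t0) * harmonic n t0 = harmonic n t"
          using harmonic_add_arg[of n "t - t0" t0] by simp
        then show ?thesis unfolding gen by simp
      qed
      finally have "abs_sums (\<lambda>k. ?e (n, k)) UNIV (?y n)" unfolding e .
      then show ?thesis
        unfolding fib by (rule iffD2[OF abs_sums_reindex, rotated]) (simp add: inj_on_def)
    qed
    then have "abs_sums ?y UNIV x"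
      by (intro abs_sums_regroup(1)[OF x, where p = fst]) auto
    moreover have "abs_sums ?y UNIV (scaleC (?\<phi> (t - t0)) (f t) + scaleC (- ?\<phi> (t - t0)) (f t0))"
      by (intro abs_sums_add abs_sums_scale f)
    ultimately have "x = scaleC (?\<phi> (t - t0)) (f t) + scaleC (- ?\<phi> (t - t0)) (f t0)"
      by (rule abs_sums_unique)
    then have "x = scaleC (?\<phi> (t - t0)) (f t)" using f0 by simp
    then show ?thesis using x by simp
  qed
  from wiener_series_of_family[OF dS _ this] Nd_sum
  show "\<exists>c'. wiener_series scaleC S N c' (\<lambda>t. scaleC (?\<phi> (t - t0)) (f t)) \<and>
         (\<Sum>\<^sub>\<infinity>n. N (c' n)) \<le> (\<Sum>\<^sub>\<infinity>n. variation p n * N (c n))"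
    by (auto simp: has_sum_imp_summable infsumI)
qed

text \<open>
  For the finitely many frequencies \<open>n \<in> M\<close> that carry most of \<open>f\<close>, the cutoff function is
  chosen with \<open>variation p n \<le> \<bar>n\<bar> * variation p 1\<close> small. For the others the uniform bound
  \<open>variation p n \<le> 6\<close> suffices.
\<close>

lemma wiener_localization:
  assumes c: "wiener_series scaleC S N c f" and f0: "f t0 = 0" and \<epsilon>: "\<epsilon> > 0"
  shows "\<exists>\<phi> \<eta> c'. \<eta> > 0 \<and> (\<forall>t. \<bar>t - t0\<bar> \<le> \<eta> \<longrightarrow> \<phi> t = 1) \<and>
     wiener_series scaleC S N c' (\<lambda>t. scaleC (\<phi> t) (f t)) \<and> (\<Sum>\<^sub>\<infinity>n. N (c' n)) \<le> \<epsilon>"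
proof -
  have cS: "c n \<in> S" and summ: "(\<lambda>n. N (c n)) summable_on UNIV" for n
    using c unfolding wiener_series_iff by auto
  have pos: "0 \<le> N (c n)" for n using norm_nonneg[OF cS] .
  have "\<exists>M. finite M \<and> M \<subseteq> UNIV \<and> dist (\<Sum>n\<in>M. N (c n)) (\<Sum>\<^sub>\<infinity>n. N (c n)) \<le> \<epsilon> / 12"
    using \<epsilon> by (intro has_sum_finite_approximation has_sum_infsum summ) simp
  then obtain M where M: "finite M" "dist (\<Sum>n\<in>M. N (c n)) (\<Sum>\<^sub>\<infinity>n. N (c n)) \<le> \<epsilon> / 12"
    by blast
  \<comment> \<open>The summand 1 only keeps \<open>B\<close> positive.\<close>
  define B where "B = 1 + (\<Sum>n\<in>M. real_of_int \<bar>n\<bar> * N (c n))"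
  have "0 \<le> (\<Sum>n\<in>M. real_of_int \<bar>n\<bar> * N (c n))"
    using pos by (intro sum_nonneg mult_nonneg_nonneg) auto
  then have B: "0 < B" unfolding B_def by linarith
  obtain p \<eta> where p: "\<eta> > 0" "(\<lambda>k. \<bar>p k\<bar>) summable_on UNIV" "(\<Sum>\<^sub>\<infinity>k. \<bar>p k\<bar>) \<le> 3"
    "variation p 1 \<le> \<epsilon> / (2 * B)"
    "\<And>t. \<bar>t\<bar> \<le> \<eta> \<Longrightarrow> (\<Sum>\<^sub>\<infinity>k. of_real (p k) * harmonic k t) = 1"
    using cutoff_exists[of "\<epsilon> / (2 * B)"] \<epsilon> B by auto
  note v = wiener_series_cutoff[OF c f0 p(2)]
  have tail: "(\<Sum>\<^sub>\<infinity>n\<in>UNIV - M. N (c n)) \<le> \<epsilon> / 12"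
  proof -
    have "(\<Sum>\<^sub>\<infinity>n\<in>UNIV - M. N (c n)) = (\<Sum>\<^sub>\<infinity>n. N (c n)) - (\<Sum>n\<in>M. N (c n))"
      using infsum_Diff[OF summ summable_on_finite[OF M(1)]] M(1) by simp
    then show ?thesis using M(2) unfolding dist_real_def by linarith
  qed
  have "(\<Sum>\<^sub>\<infinity>n. variation p n * N (c n)) =
      (\<Sum>\<^sub>\<infinity>n\<in>M. variation p n * N (c n)) + (\<Sum>\<^sub>\<infinity>n\<in>UNIV - M. variation p n * N (c n))"
    using infsum_Un_disjoint[of "\<lambda>n. variation p n * N (c n)" M "UNIV - M"] v(1) M(1)
    by (simp add: summable_on_subset[OF v(1)] del: infsum_finite)
  also have "(\<Sum>\<^sub>\<infinity>n\<in>M. variation p n * N (c n)) \<le> variation p 1 * (\<Sum>n\<in>M. real_of_int \<bar>n\<bar> * N (c n))"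
    unfolding infsum_finite[OF M(1)] sum_distrib_left
  proof (rule sum_mono)
    show "variation p n * N (c n) \<le> variation p 1 * (real_of_int \<bar>n\<bar> * N (c n))" for n
      using mult_right_mono[OF variation_le_mult[OF p(2), of n] pos[of n]] by (simp only: mult_ac)
  qed
  also have "\<dots> \<le> \<epsilon> / (2 * B) * B"
    using p(4) B \<epsilon> variation_nonneg[of p 1] \<open>0 \<le> (\<Sum>n\<in>M. real_of_int \<bar>n\<bar> * N (c n))\<close>
    by (intro mult_mono) (simp_all add: B_def)
  also have "\<dots> = \<epsilon> / 2" using B by simp
  also have "(\<Sum>\<^sub>\<infinity>n\<in>UNIV - M. variation p n * N (c n)) \<le> (\<Sum>\<^sub>\<infinity>n\<in>UNIV - M. 6 * N (c n))"
  proof (rule infsum_mono)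
    show "(\<lambda>n. variation p n * N (c n)) summable_on UNIV - M" by (rule summable_on_subset[OF v(1)]) simp
    show "(\<lambda>n. 6 * N (c n)) summable_on UNIV - M"
      by (intro summable_on_cmult_right summable_on_subset[OF summ]) simp
    show "variation p n * N (c n) \<le> 6 * N (c n)" for n
      using order_trans[OF variation_le_2[OF p(2), of n], of 6] p(3) pos by (intro mult_right_mono) auto
  qed
  also have "\<dots> = 6 * (\<Sum>\<^sub>\<infinity>n\<in>UNIV - M. N (c n))" by (rule infsum_cmult_right')
  also have "\<dots> \<le> \<epsilon> / 2" using tail by simp
  finally have small: "(\<Sum>\<^sub>\<infinity>n. variation p n * N (c n)) \<le> \<epsilon>" by simp
  obtain c' where c': "wiener_series scaleC S N c'
           (\<lambda>t. scaleC (\<Sum>\<^sub>\<infinity>k. of_real (p k) * harmonic k (t - t0)) (f t))"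
    "(\<Sum>\<^sub>\<infinity>n. N (c' n)) \<le> (\<Sum>\<^sub>\<infinity>n. variation p n * N (c n))" using v(2) by blast
  have "(\<Sum>\<^sub>\<infinity>n. N (c' n)) \<le> \<epsilon>" using c'(2) small by linarith
  moreover have "\<forall>t. \<bar>t - t0\<bar> \<le> \<eta> \<longrightarrow> (\<Sum>\<^sub>\<infinity>k. of_real (p k) * harmonic k (t - t0)) = 1"
    using p(5) by blast
  ultimately show ?thesis using p(1) c'(1) by (intro exI conjI)
qed

end

section \<open>The Wiener algebra of a strong algebra\<close>

lemma sum_prod_list_fixed_length:
  fixes u :: "'b \<Rightarrow> real"
  assumes "finite G"
  shows "(\<Sum>l\<in>{l. set l \<subseteq> G \<and> length l = k}. prod_list (map u l)) = (sum u G) ^ k"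
proof (induction k)
  case 0
  have "{l. set l \<subseteq> G \<and> length l = 0} = {[]}" by auto
  then show ?case by simp
next
  case (Suc k)
  let ?L = "{l. set l \<subseteq> G \<and> length l = k}"
  have inj: "inj_on (\<lambda>(l, n). n # l) (?L \<times> G)" by (auto simp: inj_on_def)
  have "(\<Sum>l\<in>{l. set l \<subseteq> G \<and> length l = Suc k}. prod_list (map u l)) =
      (\<Sum>(l, n)\<in>?L \<times> G. prod_list (map u l) * u n)"
    unfolding lists_length_Suc_eq sum.reindex[OF inj] by (intro sum.cong) (auto simp: mult.commute)
  also have "\<dots> = (\<Sum>l\<in>?L. prod_list (map u l) * sum u G)"
    unfolding sum.cartesian_product[symmetric] sum_distrib_left ..
  also have "\<dots> = (\<Sum>l\<in>?L. prod_list (map u l)) * sum u G" by (rule sum_distrib_right[symmetric])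
  also have "\<dots> = sum u G ^ Suc k" unfolding Suc by simp
  finally show ?case .
qed

text \<open>
  The products over lists of length \<open>k\<close> add up to the \<open>k\<close>-th power of \<open>\<Sum> u\<close>, so the sum over all
  lists is a geometric series.
\<close>

lemma summable_on_prod_list:
  fixes u :: "'b \<Rightarrow> real"
  assumes pos: "\<And>n. 0 \<le> u n" and summ: "u summable_on UNIV" and less: "infsum u UNIV < 1"
  shows "(\<lambda>l. prod_list (map u l)) summable_on UNIV"
proof (rule nonneg_bdd_above_summable_on)
  let ?q = "infsum u UNIV"
  have pos_l: "0 \<le> prod_list (map u l)" for l using pos by (induction l) auto
  then show "0 \<le> prod_list (map u l)" for l .
  have q: "0 \<le> ?q" by (intro infsum_nonneg pos)
  show "bdd_above (sum (\<lambda>l. prod_list (map u l)) ` {F. F \<subseteq> UNIV \<and> finite F})"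
  proof (rule bdd_aboveI2)
    fix F :: "'b list set" assume "F \<in> {F. F \<subseteq> UNIV \<and> finite F}"
    then have F: "finite F" by simp
    define G where "G = (\<Union>l\<in>F. set l)"
    define m where "m = Suc (Max (insert 0 (length ` F)))"
    let ?L = "\<lambda>k. {l. set l \<subseteq> G \<and> length l = k}"
    have G: "finite G" using F by (simp add: G_def)
    have "F \<subseteq> (\<Union>k<m. ?L k)"
    proof
      fix l assume l: "l \<in> F"
      then have "length l \<le> Max (insert 0 (length ` F))" using F by (intro Max_ge) auto
      then show "l \<in> (\<Union>k<m. ?L k)" using l by (auto simp: m_def G_def)
    qed
    then have "(\<Sum>l\<in>F. prod_list (map u l)) \<le> (\<Sum>l\<in>(\<Union>k<m. ?L k). prod_list (map u l))"
      using pos_l finite_lists_length_eq[OF G] by (intro sum_mono2) auto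
    also have "\<dots> = (\<Sum>k<m. \<Sum>l\<in>?L k. prod_list (map u l))"
      using finite_lists_length_eq[OF G] by (intro sum.UNION_disjoint) auto
    also have "\<dots> = (\<Sum>k<m. sum u G ^ k)" unfolding sum_prod_list_fixed_length[OF G] ..
    also have "\<dots> \<le> (\<Sum>k<m. ?q ^ k)"
      using finite_sum_le_infsum[OF summ G] pos by (intro sum_mono power_mono sum_nonneg) auto
    also have "\<dots> \<le> 1 / (1 - ?q)"
    proof -
      have "(\<Sum>k<m. ?q ^ k) \<le> (\<Sum>k. ?q ^ k)"
        using q less by (intro sum_le_suminf summable_geometric) auto
      also have "\<dots> = 1 / (1 - ?q)" using q less by (intro suminf_geometric) auto
      finally show ?thesis .
    qed
    finally show "(\<Sum>l\<in>F. prod_list (map u l)) \<le> 1 / (1 - ?q)" .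
  qed
qed

locale unital_strong_algebra = strong_algebra scaleC A X nrm
  for scaleC :: "complex \<Rightarrow> 'a::{ring,monoid_mult} \<Rightarrow> 'a"
    and A :: "'i set" and X :: "'i \<Rightarrow> 'a set" and nrm :: "'i \<Rightarrow> 'a \<Rightarrow> real"
begin

abbreviation (input) U :: "(real \<Rightarrow> 'a) set" where
  "U \<equiv> wiener_algebra scaleC A X nrm"

abbreviation (input) series :: "'i \<Rightarrow> (int \<Rightarrow> 'a) \<Rightarrow> (real \<Rightarrow> 'a) \<Rightarrow> bool" where
  "series \<alpha> \<equiv> wiener_series scaleC (X \<alpha>) (nrm \<alpha>)"

lemma normed_step: "\<alpha> \<in> A \<Longrightarrow> complex_normed_subspace scaleC (X \<alpha>) (nrm \<alpha>)"
  using banach complex_banach_subspace.axioms(1) by blast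

lemma mem_wiener_algebra_iff: "f \<in> U \<longleftrightarrow> (\<exists>\<alpha>\<in>A. \<exists>c. series \<alpha> c f)"
  by (simp add: wiener_algebra_def wiener_space_def)

text \<open>
  The topological comparison of the norms makes the open unit ball of the larger step contain a
  ball of the smaller one; homogeneity gives the constant.
\<close>

lemma inclusion_bounded:
  assumes \<alpha>: "\<alpha> \<in> A" and \<beta>: "\<beta> \<in> A" and sub: "X \<alpha> \<subseteq> X \<beta>"
  shows "\<exists>K. \<forall>x\<in>X \<alpha>. nrm \<beta> x \<le> K * nrm \<alpha> x"
proof -
  interpret Na: complex_normed_subspace scaleC "X \<alpha>" "nrm \<alpha>" by (rule normed_step[OF \<alpha>])
  interpret Nb: complex_normed_subspace scaleC "X \<beta>" "nrm \<beta>" by (rule normed_step[OF \<beta>])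
  have a0: "0 \<in> X \<alpha>" and b0: "0 \<in> X \<beta>"
    by (rule subspace_0[OF Na.subspace_carrier], rule subspace_0[OF Nb.subspace_carrier])
  have "openin (subtopology (norm_topology (X \<beta>) (nrm \<beta>)) (X \<alpha>)) (Nb.mball 0 1 \<inter> X \<alpha>)"
    unfolding norm_topology_def openin_subtopology by (intro exI[of _ "Nb.mball 0 1"] conjI Nb.openin_mball refl)
  then have "openin (norm_topology (X \<alpha>) (nrm \<alpha>)) (Nb.mball 0 1 \<inter> X \<alpha>)"
    by (rule coarser[OF \<alpha> \<beta> sub])
  moreover have "0 \<in> Nb.mball 0 1 \<inter> X \<alpha>" using a0 b0 by simp
  ultimately obtain r where r: "r > 0" "Na.mball 0 r \<subseteq> Nb.mball 0 1 \<inter> X \<alpha>"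
    unfolding norm_topology_def Na.openin_mtopology by blast
  have ball: "nrm \<beta> x < 1" if "x \<in> X \<alpha>" "nrm \<alpha> x < r" for x
  proof -
    have "x \<in> Na.mball 0 r"
      using that a0 Na.norm_minus_commute_carrier[OF a0 that(1)] by (simp add: norm_dist_def)
    then have "x \<in> Nb.mball 0 1" using r(2) by blast
    then show ?thesis using Nb.norm_minus_commute_carrier[OF b0, of x] by (auto simp: norm_dist_def)
  qed
  show ?thesis
  proof (intro exI[of _ "2 / r"] ballI)
    fix x assume x: "x \<in> X \<alpha>"
    show "nrm \<beta> x \<le> 2 / r * nrm \<alpha> x"
    proof (cases "x = 0")
      case True
      then show ?thesis using Na.norm_0 Nb.norm_0 by simp
    next
      case False
      then have pos: "0 < nrm \<alpha> x" using Na.norm_nonneg[OF x] Na.norm_eq_0[OF x] by linarith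
      let ?k = "of_real (r / (2 * nrm \<alpha> x)) :: complex"
      have k: "cmod ?k = r / (2 * nrm \<alpha> x)" using pos r(1) by (simp only: norm_of_real) simp
      have "nrm \<alpha> (scaleC ?k x) = r / 2" unfolding Na.norm_scale[OF x] k using pos by simp
      then have "nrm \<beta> (scaleC ?k x) < 1"
        using r(1) by (intro ball subspace_scale[OF Na.subspace_carrier x]) simp
      moreover have "x \<in> X \<beta>" using x sub by blast
      ultimately have "r / (2 * nrm \<alpha> x) * nrm \<beta> x < 1" by (simp only: Nb.norm_scale k)
      then show ?thesis using pos r(1) by (simp add: field_simps)
    qed
  qed
qed

lemma abs_sums_mono:
  assumes \<alpha>: "\<alpha> \<in> A" and \<beta>: "\<beta> \<in> A" and sub: "X \<alpha> \<subseteq> X \<beta>"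
    and c: "complex_normed_subspace.abs_sums (X \<alpha>) (nrm \<alpha>) c I x"
  shows "complex_normed_subspace.abs_sums (X \<beta>) (nrm \<beta>) c I x"
proof -
  obtain K where K: "\<And>x. x \<in> X \<alpha> \<Longrightarrow> nrm \<beta> x \<le> K * nrm \<alpha> x"
    using inclusion_bounded[OF \<alpha> \<beta> sub] by blast
  show ?thesis
    by (rule abs_sums_image[OF normed_step[OF \<alpha>] normed_step[OF \<beta>] _ subsetD[OF sub] K c])
       (simp add: Modules.additive_def)
qed

lemma wiener_series_mono:
  assumes \<alpha>: "\<alpha> \<in> A" and \<beta>: "\<beta> \<in> A" and sub: "X \<alpha> \<subseteq> X \<beta>" and f: "series \<alpha> c f"
  shows "series \<beta> c f"
proof -
  interpret Na: complex_normed_subspace scaleC "X \<alpha>" "nrm \<alpha>" by (rule normed_step[OF \<alpha>])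
  interpret Nb: complex_normed_subspace scaleC "X \<beta>" "nrm \<beta>" by (rule normed_step[OF \<beta>])
  have c: "range c \<subseteq> X \<alpha>"
    and s: "\<And>t. Na.abs_sums (\<lambda>n. scaleC (harmonic n t) (c n)) UNIV (f t)"
    using f unfolding Na.wiener_series_iff by blast+
  have s': "Nb.abs_sums (\<lambda>n. scaleC (harmonic n t) (c n)) UNIV (f t)" for t
    by (rule abs_sums_mono[OF \<alpha> \<beta> sub s])
  have cb: "c n \<in> X \<beta>" for n using c sub by blast
  have "(\<lambda>n. nrm \<beta> (scaleC (harmonic n 0) (c n))) summable_on UNIV"
    using s'[of 0] unfolding Nb.abs_sums_def by blast
  then have "(\<lambda>n. nrm \<beta> (c n)) summable_on UNIV" unfolding Nb.norm_scale_harmonic[OF cb] .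
  then show ?thesis unfolding Nb.wiener_series_iff using s' cb by (intro conjI image_subsetI allI)
qed

lemma wiener_algebra_periodic:
  assumes "f \<in> U"
  shows "f (t + 2 * pi * of_int k) = f t"
proof -
  obtain \<alpha> c where \<alpha>: "\<alpha> \<in> A" and f: "series \<alpha> c f"
    using assms unfolding mem_wiener_algebra_iff by blast
  show ?thesis by (rule complex_normed_subspace.wiener_series_periodic[OF normed_step[OF \<alpha>] f])
qed

lemma step_of_element: "\<exists>\<alpha>\<in>A. x \<in> X \<alpha>"
proof -
  have "x \<in> (\<Union>\<alpha>\<in>A. X \<alpha>)" unfolding Union_steps by (rule UNIV_I)
  then show ?thesis by (rule UN_E) (rule bexI)
qed

lemma common_step:
  assumes "\<alpha> \<in> A" "\<beta> \<in> A" "\<gamma> \<in> A"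
  obtains \<delta> where "\<delta> \<in> A" "X \<alpha> \<subseteq> X \<delta>" "X \<beta> \<subseteq> X \<delta>" "X \<gamma> \<subseteq> X \<delta>"
proof -
  obtain \<epsilon> where \<epsilon>: "\<epsilon> \<in> A" "X \<alpha> \<subseteq> X \<epsilon>" "X \<beta> \<subseteq> X \<epsilon>"
    using directed[OF assms(1,2)] by blast
  obtain \<delta> where \<delta>: "\<delta> \<in> A" "X \<epsilon> \<subseteq> X \<delta>" "X \<gamma> \<subseteq> X \<delta>"
    using directed[OF \<epsilon>(1) assms(3)] by blast
  show ?thesis
    by (rule that[OF \<delta>(1) order_trans[OF \<epsilon>(2) \<delta>(2)] order_trans[OF \<epsilon>(3) \<delta>(2)] \<delta>(3)])
qed

lemma wiener_algebra_add:
  assumes "f \<in> U" "g \<in> U"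
  shows "(\<lambda>t. f t + g t) \<in> U"
proof -
  obtain \<alpha> \<beta> c d where f: "\<alpha> \<in> A" "series \<alpha> c f" and g: "\<beta> \<in> A" "series \<beta> d g"
    using assms unfolding mem_wiener_algebra_iff by blast
  obtain \<gamma> where \<gamma>: "\<gamma> \<in> A" "X \<alpha> \<subseteq> X \<gamma>" "X \<beta> \<subseteq> X \<gamma>" using directed[OF f(1) g(1)] by blast
  interpret N: complex_normed_subspace scaleC "X \<gamma>" "nrm \<gamma>" by (rule normed_step[OF \<gamma>(1)])
  have "series \<gamma> c f" by (rule wiener_series_mono[OF f(1) \<gamma>(1,2) f(2)])
  moreover have "series \<gamma> d g" by (rule wiener_series_mono[OF g(1) \<gamma>(1,3) g(2)])
  ultimately have fg: "c n \<in> X \<gamma>" "d n \<in> X \<gamma>" "N.abs_sums (\<lambda>n. scaleC (harmonic n t) (c n)) UNIV (f t)"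
    "N.abs_sums (\<lambda>n. scaleC (harmonic n t) (d n)) UNIV (g t)" for n t
    unfolding N.wiener_series_iff by blast+
  have cd: "c n + d n \<in> X \<gamma>" for n by (intro subspace_add[OF N.subspace_carrier] fg)
  have s: "N.abs_sums (\<lambda>n. scaleC (harmonic n t) (c n + d n)) UNIV (f t + g t)" for t
    unfolding scale_right_distrib by (rule N.abs_sums_add[OF fg(3,4)])
  have "(\<lambda>n. nrm \<gamma> (scaleC (harmonic n 0) (c n + d n))) summable_on UNIV"
    using s[of 0] unfolding N.abs_sums_def by blast
  then have "(\<lambda>n. nrm \<gamma> (c n + d n)) summable_on UNIV" unfolding N.norm_scale_harmonic[OF cd] .
  then have "series \<gamma> (\<lambda>n. c n + d n) (\<lambda>t. f t + g t)"
    unfolding N.wiener_series_iff using s cd by (intro conjI image_subsetI allI)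
  then show ?thesis unfolding mem_wiener_algebra_iff using \<gamma>(1) by blast
qed

lemma wiener_algebra_fourier:
  assumes q: "(\<lambda>k. cmod (q k)) summable_on UNIV"
  shows "(\<lambda>t. scaleC (\<Sum>\<^sub>\<infinity>k. q k * harmonic k t) x) \<in> U"
proof -
  obtain \<alpha> where \<alpha>: "\<alpha> \<in> A" "x \<in> X \<alpha>" using step_of_element by blast
  interpret N: complex_normed_subspace scaleC "X \<alpha>" "nrm \<alpha>" by (rule normed_step[OF \<alpha>(1)])
  have in_X: "scaleC (q k) x \<in> X \<alpha>" for k by (rule subspace_scale[OF N.subspace_carrier \<alpha>(2)])
  have s: "N.abs_sums (\<lambda>k. scaleC (harmonic k t) (scaleC (q k) x)) UNIV
      (scaleC (\<Sum>\<^sub>\<infinity>k. q k * harmonic k t) x)" for t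
  proof -
    have n: "(\<lambda>k. cmod (q k * harmonic k t)) summable_on UNIV"
      unfolding norm_mult norm_harmonic using q by simp
    have "N.abs_sums (\<lambda>k. scaleC (q k * harmonic k t) x) UNIV (scaleC (\<Sum>\<^sub>\<infinity>k. q k * harmonic k t) x)"
      by (rule N.abs_sums_scale_left[OF \<alpha>(2) n has_sum_infsum[OF abs_summable_summable[OF n]]])
    then show ?thesis unfolding scale_scale by (simp only: mult.commute)
  qed
  have "(\<lambda>k. nrm \<alpha> (scaleC (harmonic k 0) (scaleC (q k) x))) summable_on UNIV"
    using s[of 0] unfolding N.abs_sums_def by blast
  then have "(\<lambda>k. nrm \<alpha> (scaleC (q k) x)) summable_on UNIV" unfolding N.norm_scale_harmonic[OF in_X] .
  then have "series \<alpha> (\<lambda>k. scaleC (q k) x) (\<lambda>t. scaleC (\<Sum>\<^sub>\<infinity>k. q k * harmonic k t) x)"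
    unfolding N.wiener_series_iff using s in_X by (intro conjI image_subsetI allI)
  then show ?thesis unfolding mem_wiener_algebra_iff using \<alpha>(1) by blast
qed

lemma wiener_algebra_const: "(\<lambda>t. x) \<in> U"
proof -
  let ?q = "\<lambda>k::int. if k = 0 then 1 else 0 :: complex"
  have "(\<lambda>k. cmod (?q k)) summable_on UNIV"
    by (rule finite_nonzero_values_imp_summable_on) simp
  note U = wiener_algebra_fourier[OF this, of x]
  have "((\<lambda>k. ?q k * harmonic k t) has_sum 1) UNIV" for t
    by (rule has_sum_finite_neutralI[of "{0}"]) auto
  then have "(\<Sum>\<^sub>\<infinity>k. ?q k * harmonic k t) = 1" for t by (rule infsumI)
  then show ?thesis using U by simp
qed

text \<open>
  The step that controls products with \<open>X \<alpha>\<close> can be taken above any two given steps.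
\<close>

lemma strong_bound:
  assumes "\<alpha> \<in> A" "\<beta> \<in> A" "\<gamma> \<in> A"
  obtains \<delta> C where "\<delta> \<in> A" "X \<beta> \<subseteq> X \<delta>" "X \<gamma> \<subseteq> X \<delta>" "0 < C"
    "\<And>a b. a \<in> X \<alpha> \<Longrightarrow> b \<in> X \<delta> \<Longrightarrow> a * b \<in> X \<delta>"
    "\<And>a b. a \<in> X \<alpha> \<Longrightarrow> b \<in> X \<delta> \<Longrightarrow> b * a \<in> X \<delta>"
    "\<And>a b. a \<in> X \<alpha> \<Longrightarrow> b \<in> X \<delta> \<Longrightarrow> nrm \<delta> (a * b) \<le> C * nrm \<alpha> a * nrm \<delta> b"
    "\<And>a b. a \<in> X \<alpha> \<Longrightarrow> b \<in> X \<delta> \<Longrightarrow> nrm \<delta> (b * a) \<le> C * nrm \<alpha> a * nrm \<delta> b"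
proof -
  obtain h where h: "h \<in> A" "\<forall>\<beta>\<in>A. X h \<subseteq> X \<beta> \<longrightarrow>
          (\<exists>C>0. \<forall>a\<in>X \<alpha>. \<forall>b\<in>X \<beta>.
             a * b \<in> X \<beta> \<and> nrm \<beta> (a * b) \<le> C * nrm \<alpha> a * nrm \<beta> b \<and>
             b * a \<in> X \<beta> \<and> nrm \<beta> (b * a) \<le> C * nrm \<alpha> a * nrm \<beta> b)"
    using strong[OF assms(1)] by blast
  obtain \<delta> where \<delta>: "\<delta> \<in> A" "X h \<subseteq> X \<delta>" "X \<beta> \<subseteq> X \<delta>" "X \<gamma> \<subseteq> X \<delta>"
    using common_step[OF h(1) assms(2,3)] .
  then obtain C where C: "C > 0" "\<forall>a\<in>X \<alpha>. \<forall>b\<in>X \<delta>.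
             a * b \<in> X \<delta> \<and> nrm \<delta> (a * b) \<le> C * nrm \<alpha> a * nrm \<delta> b \<and>
             b * a \<in> X \<delta> \<and> nrm \<delta> (b * a) \<le> C * nrm \<alpha> a * nrm \<delta> b"
    using h(2) by blast
  show ?thesis
    by (rule that[OF \<delta>(1,3,4) C(1)]) (use C(2) in blast)+
qed

text \<open>
  The products of the coefficients form an absolutely convergent family over pairs \<open>(n, k)\<close> with
  frequency \<open>n + k\<close>. Summing first over \<open>k\<close> and then over \<open>n\<close> identifies its sum.
\<close>

lemma wiener_algebra_mult:
  assumes "f \<in> U" "g \<in> U"
  shows "(\<lambda>t. f t * g t) \<in> U"
proof -
  obtain \<alpha> \<beta> c d where f: "\<alpha> \<in> A" "series \<alpha> c f" and g: "\<beta> \<in> A" "series \<beta> d g"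
    using assms unfolding mem_wiener_algebra_iff by blast
  obtain \<delta> C where \<delta>: "\<delta> \<in> A" "X \<beta> \<subseteq> X \<delta>" "0 < C"
    and mem: "\<And>a b. a \<in> X \<alpha> \<Longrightarrow> b \<in> X \<delta> \<Longrightarrow> a * b \<in> X \<delta>"
    and bound: "\<And>a b. a \<in> X \<alpha> \<Longrightarrow> b \<in> X \<delta> \<Longrightarrow> nrm \<delta> (a * b) \<le> C * nrm \<alpha> a * nrm \<delta> b"
    using strong_bound[OF f(1) g(1) g(1)] by metis
  interpret Na: complex_normed_subspace scaleC "X \<alpha>" "nrm \<alpha>" by (rule normed_step[OF f(1)])
  interpret Nd: complex_banach_subspace scaleC "X \<delta>" "nrm \<delta>" by (rule banach[OF \<delta>(1)])
  have g': "series \<delta> d g" by (rule wiener_series_mono[OF g(1) \<delta>(1,2) g(2)])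
  have c: "c n \<in> X \<alpha>" and sc: "(\<lambda>n. nrm \<alpha> (c n)) summable_on UNIV"
    and fs: "Na.abs_sums (\<lambda>n. scaleC (harmonic n t) (c n)) UNIV (f t)" for n t
    using f(2) unfolding Na.wiener_series_iff by blast+
  have d: "d n \<in> X \<delta>" and sd: "(\<lambda>n. nrm \<delta> (d n)) summable_on UNIV"
    and gs: "Nd.abs_sums (\<lambda>n. scaleC (harmonic n t) (d n)) UNIV (g t)" for n t
    using g' unfolding Nd.wiener_series_iff by blast+
  define e where "e = (\<lambda>(n, k). c n * d k)"
  have eX: "range e \<subseteq> X \<delta>" unfolding e_def using mem[OF c d] by auto
  have se: "(\<lambda>z. nrm \<delta> (e z)) summable_on UNIV"
  proof (rule summable_on_comparison_test)
    have "(\<lambda>(n, k). C * nrm \<alpha> (c n) * nrm \<delta> (d k)) summable_on (UNIV \<times> UNIV)"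
    proof (rule summable_on_SigmaI)
      show "((\<lambda>k. case (n, k) of (n, k) \<Rightarrow> C * nrm \<alpha> (c n) * nrm \<delta> (d k)) has_sum
          C * nrm \<alpha> (c n) * (\<Sum>\<^sub>\<infinity>k. nrm \<delta> (d k))) UNIV" for n
        unfolding prod.case by (intro has_sum_cmult_right has_sum_infsum sd)
      show "(\<lambda>n. C * nrm \<alpha> (c n) * (\<Sum>\<^sub>\<infinity>k. nrm \<delta> (d k))) summable_on UNIV"
        by (intro summable_on_cmult_left summable_on_cmult_right sc)
      show "0 \<le> (case (n, k) of (n, k) \<Rightarrow> C * nrm \<alpha> (c n) * nrm \<delta> (d k))" for n k
        using \<delta>(3) Na.norm_nonneg[OF c, of n] Nd.norm_nonneg[OF d, of k] by simp
    qed
    then show "(\<lambda>(n, k). C * nrm \<alpha> (c n) * nrm \<delta> (d k)) summable_on UNIV" by simp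
    show "nrm \<delta> (e z) \<le> (case z of (n, k) \<Rightarrow> C * nrm \<alpha> (c n) * nrm \<delta> (d k))" for z
      unfolding e_def by (cases z) (simp add: bound[OF c d])
    show "0 \<le> nrm \<delta> (e z)" for z using eX by (intro Nd.norm_nonneg) blast
  qed
  let ?\<nu> = "\<lambda>z :: int \<times> int. fst z + snd z"
  have "Nd.abs_sums (\<lambda>z. scaleC (harmonic (?\<nu> z) t) (e z)) UNIV (f t * g t)" for t
  proof -
    let ?e = "\<lambda>z. scaleC (harmonic (?\<nu> z) t) (e z)"
    let ?y = "\<lambda>n. scaleC (harmonic n t) (c n) * g t"
    obtain x where x: "Nd.abs_sums ?e UNIV x"
      using Nd.abs_sums_exists[OF Nd.scale_harmonic_family(1,2)[OF eX se, of ?\<nu> t]] by blast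
    have gt: "g t \<in> X \<delta>" and ft: "f t \<in> X \<alpha>"
      using gs[of t] fs[of t] unfolding Nd.abs_sums_def Na.abs_sums_def by blast+
    have ec: "scaleC (harmonic n t) (c n) \<in> X \<alpha>" for n
      by (rule subspace_scale[OF Na.subspace_carrier c])
    have "Nd.abs_sums ?e {z \<in> UNIV. fst z = n} (?y n)" for n
    proof -
      have fib: "{z :: int \<times> int. z \<in> UNIV \<and> fst z = n} = Pair n ` UNIV" by auto
      have "Nd.abs_sums (\<lambda>k. scaleC (harmonic n t) (c n) * scaleC (harmonic k t) (d k)) UNIV (?y n)"
        by (rule abs_sums_image[OF Nd.complex_normed_subspace_axioms Nd.complex_normed_subspace_axioms
              _ mem[OF ec] bound[OF ec] gs])
           (simp_all add: Modules.additive_def distrib_left)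
      moreover have "scaleC (harmonic n t) (c n) * scaleC (harmonic k t) (d k) = ?e (n, k)" for k
        unfolding e_def prod.case fst_conv snd_conv harmonic_add mult_scale_left mult_scale_right scale_scale
        by (rule arg_cong2[where f = scaleC, OF mult.commute refl])
      ultimately have "Nd.abs_sums (\<lambda>k. ?e (n, k)) UNIV (?y n)" by (simp only:)
      then show ?thesis
        unfolding fib by (rule iffD2[OF Nd.abs_sums_reindex, rotated]) (simp add: inj_on_def)
    qed
    then have "Nd.abs_sums ?y UNIV x"
      by (intro Nd.abs_sums_regroup(1)[OF x, where p = fst]) simp_all
    moreover have "Nd.abs_sums ?y UNIV (f t * g t)"
      by (rule abs_sums_image[OF Na.complex_normed_subspace_axioms Nd.complex_normed_subspace_axioms
            _ _ _ fs, where T = "\<lambda>x. x * g t" and K = "C * nrm \<delta> (g t)"])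
         (use mem[OF _ gt] bound[OF _ gt] in \<open>simp_all add: Modules.additive_def distrib_right mult_ac\<close>)
    ultimately have "x = f t * g t" by (rule Nd.abs_sums_unique)
    then show ?thesis using x by simp
  qed
  from Nd.wiener_series_of_family[OF eX se this]
  show ?thesis unfolding mem_wiener_algebra_iff using \<delta>(1) by blast
qed

end

section \<open>Local left inverses and gluing\<close>

context unital_strong_algebra
begin

text \<open>
  The Neumann series \<open>\<Sum>\<^sub>m x\<^sup>m\<close>, expanded completely: the term of a list of frequencies is the product of
  the corresponding coefficients, and its frequency is the sum of the list. Splitting off the
  empty list and grouping the others by their tails gives \<open>y = 1 + y * x\<close>. The constant \<open>C\<close> of the
  strong algebra enters once per factor, which is why \<open>C\<close> times the norm of \<open>x\<close> has to be below 1.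
\<close>

lemma wiener_neumann:
  assumes \<alpha>: "\<alpha> \<in> A" and \<delta>: "\<delta> \<in> A" and one: "1 \<in> X \<delta>" and C: "0 < C"
    and mem: "\<And>a b. a \<in> X \<alpha> \<Longrightarrow> b \<in> X \<delta> \<Longrightarrow> b * a \<in> X \<delta>"
    and bound: "\<And>a b. a \<in> X \<alpha> \<Longrightarrow> b \<in> X \<delta> \<Longrightarrow> nrm \<delta> (b * a) \<le> C * nrm \<alpha> a * nrm \<delta> b"
    and x: "series \<alpha> c x" and small: "C * (\<Sum>\<^sub>\<infinity>n. nrm \<alpha> (c n)) < 1"
  shows "\<exists>y\<in>U. \<forall>t. y t = 1 + y t * x t"
proof -
  interpret Na: complex_normed_subspace scaleC "X \<alpha>" "nrm \<alpha>" by (rule normed_step[OF \<alpha>])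
  interpret Nd: complex_banach_subspace scaleC "X \<delta>" "nrm \<delta>" by (rule banach[OF \<delta>])
  have c: "c n \<in> X \<alpha>" and sc: "(\<lambda>n. nrm \<alpha> (c n)) summable_on UNIV"
    and xs: "Na.abs_sums (\<lambda>n. scaleC (harmonic n t) (c n)) UNIV (x t)" for n t
    using x unfolding Na.wiener_series_iff by blast+
  \<comment> \<open>New coefficients are multiplied on the right, since \<open>x\<close> acts on \<open>y\<close> from the right.\<close>
  define w where "w = rec_list 1 (\<lambda>n l v. v * c n)"
  have w_Nil: "w [] = 1" and w_Cons: "w (n # l) = w l * c n" for n l
    by (simp_all add: w_def)
  define u where "u = (\<lambda>n. C * nrm \<alpha> (c n))"
  have u_pos: "0 \<le> u n" for n using C Na.norm_nonneg[OF c] by (simp add: u_def)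
  have u_sum: "u summable_on UNIV" unfolding u_def by (rule summable_on_cmult_right[OF sc])
  have "infsum u UNIV < 1" unfolding u_def infsum_cmult_right' by (rule small)
  then have prod: "(\<lambda>l. prod_list (map u l)) summable_on UNIV"
    by (rule summable_on_prod_list[OF u_pos u_sum])
  have w: "w l \<in> X \<delta> \<and> nrm \<delta> (w l) \<le> nrm \<delta> 1 * prod_list (map u l)" for l
  proof (induction l)
    case Nil
    then show ?case using one by (simp add: w_Nil)
  next
    case (Cons n l)
    have "nrm \<delta> (w l * c n) \<le> C * nrm \<alpha> (c n) * nrm \<delta> (w l)" using bound[OF c] Cons by blast
    also have "\<dots> \<le> u n * (nrm \<delta> 1 * prod_list (map u l))"
      unfolding u_def[symmetric] using Cons u_pos[of n] unfolding u_def by (intro mult_left_mono) auto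
    finally show ?case using mem[OF c] Cons by (simp add: w_Cons mult_ac)
  qed
  have wX: "range w \<subseteq> X \<delta>" using w by blast
  have sw: "(\<lambda>l. nrm \<delta> (w l)) summable_on UNIV"
  proof (rule summable_on_comparison_test)
    show "(\<lambda>l. nrm \<delta> 1 * prod_list (map u l)) summable_on UNIV" by (rule summable_on_cmult_right[OF prod])
    show "nrm \<delta> (w l) \<le> nrm \<delta> 1 * prod_list (map u l)" for l using w by blast
    show "0 \<le> nrm \<delta> (w l)" for l using w by (intro Nd.norm_nonneg) blast
  qed
  let ?d = "\<lambda>t l. scaleC (harmonic (sum_list l) t) (w l)"
  note fam = Nd.scale_harmonic_family[OF wX sw, where \<nu> = sum_list]
  have "\<exists>v. Nd.abs_sums (?d t) UNIV v" for t by (rule Nd.abs_sums_exists[OF fam(1,2)])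
  then obtain y where y: "\<And>t. Nd.abs_sums (?d t) UNIV (y t)" by metis
  have fix_point: "y t = 1 + y t * x t" for t
  proof -
    have dX: "?d t l \<in> X \<delta>" for l using fam(1) by blast
    have xt: "x t \<in> X \<alpha>" using xs[of t] unfolding Na.abs_sums_def by blast
    let ?I = "{l :: int list. l \<noteq> []}"
    have "?d t ` ?I \<subseteq> X \<delta>" using dX by blast
    moreover have "(\<lambda>l. nrm \<delta> (?d t l)) summable_on ?I" by (rule summable_on_subset[OF fam(2)]) simp
    ultimately obtain z where z: "Nd.abs_sums (?d t) ?I z" using Nd.abs_sums_exists by blast
    have "Nd.abs_sums (?d t) {l \<in> ?I. tl l = j} (?d t j * x t)" for j
    proof -
      have fib: "{l \<in> ?I. tl l = j} = (\<lambda>n. n # j) ` UNIV"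
      proof (intro subset_antisym subsetI)
        fix l assume "l \<in> {l \<in> ?I. tl l = j}"
        then show "l \<in> (\<lambda>n. n # j) ` UNIV" by (cases l) auto
      qed auto
      have "Nd.abs_sums (\<lambda>n. ?d t j * scaleC (harmonic n t) (c n)) UNIV (?d t j * x t)"
      proof (rule abs_sums_image[OF Na.complex_normed_subspace_axioms Nd.complex_normed_subspace_axioms _ _ _ xs])
        show "Modules.additive (\<lambda>v. ?d t j * v)" by (simp add: Modules.additive_def distrib_left)
        show "?d t j * v \<in> X \<delta>" if "v \<in> X \<alpha>" for v by (rule mem[OF that dX])
        show "nrm \<delta> (?d t j * v) \<le> C * nrm \<delta> (?d t j) * nrm \<alpha> v" if "v \<in> X \<alpha>" for v
          using bound[OF that dX[of j]] by (simp only: mult_ac)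
      qed
      moreover have "?d t j * scaleC (harmonic n t) (c n) = ?d t (n # j)" for n
        unfolding w_Cons sum_list.Cons harmonic_add mult_scale_left mult_scale_right scale_scale
        by (rule refl)
      ultimately have "Nd.abs_sums (\<lambda>n. ?d t (n # j)) UNIV (?d t j * x t)" by (simp only:)
      then show ?thesis
        unfolding fib by (rule iffD2[OF Nd.abs_sums_reindex, rotated]) (simp add: inj_on_def)
    qed
    then have "Nd.abs_sums (\<lambda>j. ?d t j * x t) UNIV z"
      by (intro Nd.abs_sums_regroup(1)[OF z, where p = tl]) simp_all
    moreover have "Nd.abs_sums (\<lambda>j. ?d t j * x t) UNIV (y t * x t)"
    proof (rule abs_sums_image[OF Nd.complex_normed_subspace_axioms Nd.complex_normed_subspace_axioms _ _ _ y])
      show "Modules.additive (\<lambda>v. v * x t)" by (simp add: Modules.additive_def distrib_right)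
    qed (rule mem[OF xt], assumption, rule bound[OF xt], assumption)
    ultimately have z_eq: "z = y t * x t" by (rule Nd.abs_sums_unique)
    have "Nd.abs_sums (?d t) {[]} (sum (?d t) {[]})"
      using dX by (intro Nd.abs_sums_finite) blast+
    moreover have "sum (?d t) {[]} = 1" by (simp add: w_Nil)
    ultimately have "Nd.abs_sums (?d t) {[]} 1" by (simp only:)
    then have "Nd.abs_sums (?d t) ({[]} \<union> ?I) (1 + z)" by (rule Nd.abs_sums_Un[OF _ z]) simp
    moreover have "{[]} \<union> ?I = UNIV" by blast
    ultimately have "Nd.abs_sums (?d t) UNIV (1 + z)" by (simp only:)
    then have "y t = 1 + z" by (rule Nd.abs_sums_unique[OF y])
    then show ?thesis unfolding z_eq .
  qed
  have "y \<in> U"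
    using Nd.wiener_series_of_family[OF wX sw y] \<delta> unfolding mem_wiener_algebra_iff by blast
  with fix_point show ?thesis by blast
qed

text \<open>
  The left inverse is \<open>y * b\<close>, where \<open>y\<close> inverts \<open>1 + \<phi> * (b * a - 1)\<close> for a cutoff function \<open>\<phi>\<close>
  that is 1 near \<open>t0\<close>. The constant \<open>C\<close> of the strong algebra depends only on the steps, so the
  cutoff function can be chosen after it.
\<close>

lemma local_left_inverse:
  assumes a: "a \<in> U" and b: "b * a t0 = 1"
  shows "\<exists>h\<in>U. \<exists>\<eta>>0. \<forall>t. \<bar>t - t0\<bar> \<le> \<eta> \<longrightarrow> h t * a t = 1"
proof -
  have "(\<lambda>t. b * a t + - 1) \<in> U"
    by (intro wiener_algebra_add wiener_algebra_mult wiener_algebra_const a)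
  then obtain \<alpha> c where \<alpha>: "\<alpha> \<in> A" and f: "series \<alpha> c (\<lambda>t. b * a t + - 1)"
    unfolding mem_wiener_algebra_iff by blast
  obtain \<gamma> where \<gamma>: "\<gamma> \<in> A" "1 \<in> X \<gamma>" using step_of_element by blast
  obtain \<delta> C where \<delta>: "\<delta> \<in> A" "X \<gamma> \<subseteq> X \<delta>" "0 < C"
    and mem: "\<And>a b. a \<in> X \<alpha> \<Longrightarrow> b \<in> X \<delta> \<Longrightarrow> b * a \<in> X \<delta>"
    and bound: "\<And>a b. a \<in> X \<alpha> \<Longrightarrow> b \<in> X \<delta> \<Longrightarrow> nrm \<delta> (b * a) \<le> C * nrm \<alpha> a * nrm \<delta> b"
    using strong_bound[OF \<alpha> \<gamma>(1) \<gamma>(1)] by metis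
  have one: "1 \<in> X \<delta>" using \<gamma>(2) \<delta>(2) by blast
  interpret Na: complex_banach_subspace scaleC "X \<alpha>" "nrm \<alpha>" by (rule banach[OF \<alpha>])
  let ?f = "\<lambda>t. - (b * a t + - 1)"
  have f': "series \<alpha> (\<lambda>n. scaleC (-1) (c n)) ?f"
  proof -
    have c: "c n \<in> X \<alpha>" and sc: "(\<lambda>n. nrm \<alpha> (c n)) summable_on UNIV"
      and fs: "Na.abs_sums (\<lambda>n. scaleC (harmonic n t) (c n)) UNIV (b * a t + - 1)" for n t
      using f unfolding Na.wiener_series_iff by blast+
    have c': "scaleC (-1) (c n) \<in> X \<alpha>" for n by (rule subspace_scale[OF Na.subspace_carrier c])
    have n: "nrm \<alpha> (scaleC (-1) (c n)) = nrm \<alpha> (c n)" for n unfolding Na.norm_scale[OF c] by simp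
    have "Na.abs_sums (\<lambda>n. scaleC (-1) (scaleC (harmonic n t) (c n))) UNIV (scaleC (-1) (b * a t + - 1))" for t
      by (rule Na.abs_sums_scale[OF fs])
    then have s: "Na.abs_sums (\<lambda>n. scaleC (harmonic n t) (scaleC (-1) (c n))) UNIV (?f t)" for t
      unfolding scale_scale by (simp only: mult.commute scale_minus_left scale_one)
    show ?thesis
      unfolding Na.wiener_series_iff n by (intro conjI image_subsetI allI c' sc s)
  qed
  have "?f t0 = 0" by (simp add: b)
  moreover have "0 < 1 / (2 * C)" using \<delta>(3) by simp
  ultimately obtain \<phi> \<eta> c' where \<eta>: "\<eta> > 0" and \<phi>: "\<And>t. \<bar>t - t0\<bar> \<le> \<eta> \<Longrightarrow> \<phi> t = 1"
    and c': "series \<alpha> c' (\<lambda>t. scaleC (\<phi> t) (?f t))" "(\<Sum>\<^sub>\<infinity>n. nrm \<alpha> (c' n)) \<le> 1 / (2 * C)"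
    using Na.wiener_localization[OF f'] by blast
  have "C * (\<Sum>\<^sub>\<infinity>n. nrm \<alpha> (c' n)) \<le> C * (1 / (2 * C))"
    using c'(2) \<delta>(3) by (intro mult_left_mono) simp_all
  also have "\<dots> < 1" using \<delta>(3) by simp
  finally obtain y where y: "y \<in> U" "\<And>t. y t = 1 + y t * scaleC (\<phi> t) (?f t)"
    using wiener_neumann[OF \<alpha> \<delta>(1) one \<delta>(3) mem bound c'(1)] by blast
  show ?thesis
  proof (intro bexI[of _ "\<lambda>t. y t * b"] exI[of _ \<eta>] conjI allI impI \<eta>)
    show "(\<lambda>t. y t * b) \<in> U" by (intro wiener_algebra_mult wiener_algebra_const y(1))
    fix t assume "\<bar>t - t0\<bar> \<le> \<eta>"
    then have "y t = 1 + y t * ?f t" using y(2)[of t] \<phi>[of t] by simp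
    then show "y t * b * a t = 1" by (simp add: right_diff_distrib mult.assoc)
  qed
qed

lemma wiener_algebra_sum:
  assumes "finite J" "\<And>j. j \<in> J \<Longrightarrow> f j \<in> U"
  shows "(\<lambda>t. \<Sum>j\<in>J. f j t) \<in> U"
  using assms
proof (induction J rule: finite_induct)
  case empty
  show ?case using wiener_algebra_const[of 0] by simp
next
  case (insert j J)
  have "(\<lambda>t. f j t + (\<Sum>j\<in>J. f j t)) \<in> U"
    by (rule wiener_algebra_add) (use insert in \<open>simp_all\<close>)
  then show ?case using insert.hyps by simp
qed

lemma reduce_mod_2pi:
  obtains k :: int where "-pi \<le> t - 2 * pi * of_int k" "t - 2 * pi * of_int k < pi"
proof
  let ?k = "\<lfloor>(t + pi) / (2 * pi)\<rfloor>"
  have "of_int ?k \<le> (t + pi) / (2 * pi)" "(t + pi) / (2 * pi) < of_int ?k + 1" by linarith+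
  moreover have "0 < 2 * pi" by simp
  ultimately have "of_int ?k * (2 * pi) \<le> t + pi" "t + pi < (of_int ?k + 1) * (2 * pi)"
    by (simp_all only: pos_le_divide_eq pos_divide_less_eq)
  then show "-pi \<le> t - 2 * pi * of_int ?k" "t - 2 * pi * of_int ?k < pi"
    by (simp_all add: algebra_simps)
qed

text \<open>
  A Lebesgue number \<open>e\<close> of the cover by the intervals with local left inverses determines the
  number \<open>m\<close> of triangles: their half-width \<open>2 * pi / m\<close> is at most \<open>e\<close>, so each triangle is supported, up to
  periods, where a single local left inverse works.
\<close>

lemma left_inverse_of_pointwise:
  assumes a: "a \<in> U" and inv: "\<And>t. t \<in> {-pi..<pi} \<Longrightarrow> \<exists>b. b * a t = 1"
  shows "\<exists>a'\<in>U. \<forall>t. a' t * a t = 1"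
proof -
  have inv': "\<exists>b. b * a t = 1" for t
  proof -
    obtain k :: int where "-pi \<le> t - 2 * pi * of_int k" "t - 2 * pi * of_int k < pi"
      by (rule reduce_mod_2pi)
    then have "\<exists>b. b * a (t - 2 * pi * of_int k) = 1" by (intro inv) simp
    then show ?thesis using wiener_algebra_periodic[OF a, of "t - 2 * pi * of_int k" k] by simp
  qed
  have "\<exists>h \<eta>. h \<in> U \<and> \<eta> > 0 \<and> (\<forall>s. \<bar>s - t\<bar> \<le> \<eta> \<longrightarrow> h s * a s = 1)" for t
    using local_left_inverse[OF a] inv'[of t] by blast
  then obtain h \<eta> where h: "\<And>t. h t \<in> U" and \<eta>: "\<And>t. \<eta> t > 0"
    and ha: "\<And>t s. \<bar>s - t\<bar> \<le> \<eta> t \<Longrightarrow> h t s * a s = 1"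
    by metis
  obtain e where e: "0 < e" "\<And>t. t \<in> {0..2 * pi} \<Longrightarrow> \<exists>G\<in>range (\<lambda>t. ball t (\<eta> t)). ball t e \<subseteq> G"
  proof (rule Heine_Borel_lemma[of "{0..2 * pi}" "range (\<lambda>t. ball t (\<eta> t))"])
    have "t \<in> \<Union> (range (\<lambda>t. ball t (\<eta> t)))" for t
      by (rule UnionI[of "ball t (\<eta> t)"]) (simp_all add: \<eta>)
    then show "{0..2 * pi} \<subseteq> \<Union> (range (\<lambda>t. ball t (\<eta> t)))" by blast
  qed auto
  \<comment> \<open>\<open>m \<ge> 2\<close> keeps the half-width within \<open>pi\<close>, so that a triangle does not overlap its own periods.\<close>
  define m where "m = nat \<lceil>2 * pi / e\<rceil> + 2"
  define d where "d = 2 * pi / real m"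
  have m: "2 \<le> m" "0 < real m" by (simp_all add: m_def)
  have "2 * pi / e < real m" unfolding m_def by linarith
  then have d: "0 < d" "d \<le> e" "d \<le> pi"
    using e(1) m by (simp_all add: d_def field_simps)
  define T where "T = (\<lambda>t. \<Sum>\<^sub>\<infinity>k. of_real (triangle_coeff d k) * harmonic k t)"
  let ?t = "\<lambda>j. 2 * pi * real j / real m"
  have "\<exists>s. ball (?t j) e \<subseteq> ball s (\<eta> s)" if "j < m" for j
  proof -
    have "?t j \<in> {0..2 * pi}" using that by (simp add: field_simps)
    then show ?thesis using e(2)[of "?t j"] by blast
  qed
  then obtain s where s: "\<And>j. j < m \<Longrightarrow> ball (?t j) e \<subseteq> ball (s j) (\<eta> (s j))" by metis
  have supp: "scaleC (T (t - ?t j)) (h (s j) t * a t) = scaleC (T (t - ?t j)) 1" if j: "j < m" for j t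
  proof -
    obtain k :: int where k: "-pi \<le> (t - ?t j) - 2 * pi * of_int k" "(t - ?t j) - 2 * pi * of_int k < pi"
      by (rule reduce_mod_2pi)
    define r where "r = t - ?t j - 2 * pi * of_int k"
    have r: "\<bar>r\<bar> \<le> pi" using k unfolding r_def by linarith
    have "harmonic n (t - ?t j) = harmonic n r" for n
      using harmonic_periodic[of n r k] by (simp add: r_def)
    then have Tr: "T (t - ?t j) = of_real (max 0 (1 - \<bar>r\<bar> / d))"
      unfolding T_def using infsumI[OF triangle_has_sum[OF d(1,3) r]] by (simp only:)
    show ?thesis
    proof (cases "\<bar>r\<bar> < d")
      case True
      have "?t j + r \<in> ball (?t j) e" using True d(2) by (simp add: dist_real_def)
      then have "?t j + r \<in> ball (s j) (\<eta> (s j))" using s[OF j] by blast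
      then have "h (s j) (?t j + r) * a (?t j + r) = 1"
        by (intro ha) (simp add: dist_real_def abs_minus_commute)
      moreover have "t = (?t j + r) + 2 * pi * of_int k" by (simp add: r_def)
      then have "h (s j) t = h (s j) (?t j + r)" "a t = a (?t j + r)"
        using wiener_algebra_periodic[OF h, of "s j" "?t j + r" k]
          wiener_algebra_periodic[OF a, of "?t j + r" k] by (simp_all only:)
      ultimately show ?thesis by (simp only:)
    next
      case False
      then have "max 0 (1 - \<bar>r\<bar> / d) = 0" using d(1) by (simp add: max_def)
      then show ?thesis unfolding Tr by simp
    qed
  qed
  have TU: "(\<lambda>t. scaleC (T (t - ?t j)) 1) \<in> U" for j
  proof -
    have "(\<lambda>k. cmod (of_real (triangle_coeff d k) * harmonic k (- ?t j))) summable_on UNIV"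
      unfolding norm_mult norm_harmonic using summable_triangle_coeff(1)[OF d(1,3)] by simp
    then have "(\<lambda>t. scaleC (\<Sum>\<^sub>\<infinity>k. of_real (triangle_coeff d k) * harmonic k (- ?t j) * harmonic k t) 1) \<in> U"
      by (rule wiener_algebra_fourier)
    moreover have "of_real (triangle_coeff d k) * harmonic k (- ?t j) * harmonic k t =
        of_real (triangle_coeff d k) * harmonic k (t - ?t j)" for k t
      using harmonic_add_arg[of k "- ?t j" t] by (simp add: mult.assoc)
    ultimately show ?thesis unfolding T_def by (simp only:)
  qed
  let ?a' = "\<lambda>t. \<Sum>j<m. scaleC (T (t - ?t j)) 1 * h (s j) t"
  have a'U: "?a' \<in> U" by (intro wiener_algebra_sum wiener_algebra_mult TU h) simp
  have "?a' t * a t = 1" for t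
  proof -
    have "?a' t * a t = (\<Sum>j<m. scaleC (T (t - ?t j)) (h (s j) t * a t))"
      by (simp only: sum_distrib_right mult_scale_left mult_1_left)
    also have "\<dots> = (\<Sum>j<m. scaleC (T (t - ?t j)) 1)"
      by (intro sum.cong refl supp) simp
    also have "\<dots> = scaleC (\<Sum>j<m. T (t - ?t j)) 1" by (rule scale_sum_left[symmetric])
    also have "(\<Sum>j<m. T (t - ?t j)) = 1"
      unfolding T_def d_def by (rule triangle_partition_of_unity[OF m(1)])
    finally show ?thesis by simp
  qed
  then show ?thesis by (intro bexI[OF _ a'U] allI)
qed

end

theorem theorem5p4:
  fixes scaleC :: "complex \<Rightarrow> 'a::{ring,monoid_mult} \<Rightarrow> 'a"
    and A :: "'i set" and X :: "'i \<Rightarrow> 'a set" and nrm :: "'i \<Rightarrow> 'a \<Rightarrow> real"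
    and a :: "real \<Rightarrow> 'a"
  assumes "strong_algebra scaleC A X nrm"
    and "a \<in> wiener_algebra scaleC A X nrm"
  shows "left_invertible_in (wiener_algebra scaleC A X nrm) a \<longleftrightarrow>
         (\<forall>t\<in>{-pi..<pi}. left_invertible_in (\<Union>\<alpha>\<in>A. X \<alpha>) (a t))"
proof -
  interpret strong_algebra scaleC A X nrm by fact
  interpret unital_strong_algebra scaleC A X nrm by unfold_locales
  show ?thesis
  proof
    assume "left_invertible_in (wiener_algebra scaleC A X nrm) a"
    then obtain a' where "a' * a = 1" unfolding left_invertible_in_def by blast
    then have "a' t * a t = 1" for t by (metis times_fun_apply one_fun_apply)
    then show "\<forall>t\<in>{-pi..<pi}. left_invertible_in (\<Union>\<alpha>\<in>A. X \<alpha>) (a t)"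
      unfolding left_invertible_in_def Union_steps by blast
  next
    assume "\<forall>t\<in>{-pi..<pi}. left_invertible_in (\<Union>\<alpha>\<in>A. X \<alpha>) (a t)"
    then have "\<exists>b. b * a t = 1" if "t \<in> {-pi..<pi}" for t
      using that unfolding left_invertible_in_def by blast
    from left_inverse_of_pointwise[OF assms(2) this]
    obtain a' where a': "a' \<in> wiener_algebra scaleC A X nrm" "\<forall>t. a' t * a t = 1" by blast
    have "a' * a = 1" by (rule ext) (simp add: a'(2) times_fun_apply one_fun_apply)
    with a'(1) show "left_invertible_in (wiener_algebra scaleC A X nrm) a"
      unfolding left_invertible_in_def by blast
  qed
qed

end
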